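(* Let $A\in \mathbb{Z}^{m\times n}$, $b\in \mathbb{Z}^m$, and $P:=\{x:Ax\leq b\}$. For a nonempty face $F$ of $P$, let $A_F x\le b_F$ be the subsystem of $Ax\le b$ consisting of the inequalities satisfied with equality by all points of $F$. Then the following are equivalent: (1) $Ax\leq b$ is totally dual $p$-adic for all primes $p$; (2) $Ax\leq b$ is totally dual $p$-adic and totally dual $q$-adic for some distinct primes $p,q$; (3) for every nonempty face $F$ of $P$, the GCD of the subdeterminants of $A_F$ of order $\operatorname{rank}(A_F)$ is $1$.
   Context: For a prime $p$, a $p$-adic rational is a number $a/p^k$ with $a,k\in\mathbb{Z}$, $k\ge0$; a vector is $p$-adic if all entries are $p$-adic rationals. A system $Ax\le b$ with integral $A,b$ is totally dual $p$-adic if for every integral $w$ for which $\min\{b^\top y: A^\top y=w,\ y\ge \mathbf{0}\}$ has an optimal solution, it has a $p$-adic optimal solution. *)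

theory Defs
  imports "Jordan_Normal_Form.DL_Rank_Submatrix"
begin

definition padic :: "nat \<Rightarrow> real \<Rightarrow> bool" where
  "padic p r \<longleftrightarrow> (\<exists>(a::int) (k::nat). r = real_of_int a / real p ^ k)"

definition polyhedron :: "int mat \<Rightarrow> int vec \<Rightarrow> real vec set" where
  "polyhedron A b = {x \<in> carrier_vec (dim_col A).
      \<forall>i < dim_row A. row (map_mat real_of_int A) i \<bullet> x \<le> real_of_int (b $ i)}"

definition dual_feasible :: "int mat \<Rightarrow> int vec \<Rightarrow> real vec \<Rightarrow> bool" where
  "dual_feasible A w y \<longleftrightarrow> y \<in> carrier_vec (dim_row A) \<and>
      transpose_mat (map_mat real_of_int A) *\<^sub>v y = map_vec real_of_int w \<and>
      (\<forall>i < dim_row A. y $ i \<ge> 0)"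

definition dual_optimal :: "int mat \<Rightarrow> int vec \<Rightarrow> int vec \<Rightarrow> real vec \<Rightarrow> bool" where
  "dual_optimal A b w y \<longleftrightarrow> dual_feasible A w y \<and>
      (\<forall>y'. dual_feasible A w y' \<longrightarrow>
         map_vec real_of_int b \<bullet> y \<le> map_vec real_of_int b \<bullet> y')"

definition totally_dual_padic :: "int mat \<Rightarrow> int vec \<Rightarrow> nat \<Rightarrow> bool" where
  "totally_dual_padic A b p \<longleftrightarrow>
     (\<forall>w \<in> carrier_vec (dim_col A).
        (\<exists>y. dual_optimal A b w y) \<longrightarrow>
        (\<exists>y. dual_optimal A b w y \<and> (\<forall>i < dim_row A. padic p (y $ i))))"

(* faces of P (Schrijver): F = P \<inter> {x. c x = \<delta>} for a valid inequality c x \<le> \<delta>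
   (c = 0, \<delta> = 0 gives P itself) *)
definition is_face :: "int mat \<Rightarrow> int vec \<Rightarrow> real vec set \<Rightarrow> bool" where
  "is_face A b F \<longleftrightarrow> (\<exists>c \<delta>. c \<in> carrier_vec (dim_col A) \<and>
      (\<forall>x \<in> polyhedron A b. c \<bullet> x \<le> \<delta>) \<and>
      F = {x \<in> polyhedron A b. c \<bullet> x = \<delta>})"

definition tight_rows :: "int mat \<Rightarrow> int vec \<Rightarrow> real vec set \<Rightarrow> nat set" where
  "tight_rows A b F = {i. i < dim_row A \<and>
      (\<forall>x \<in> F. row (map_mat real_of_int A) i \<bullet> x = real_of_int (b $ i))}"

definition face_matrix :: "int mat \<Rightarrow> int vec \<Rightarrow> real vec set \<Rightarrow> int mat" where
  "face_matrix A b F = submatrix A (tight_rows A b F) {..<dim_col A}"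

definition int_rank :: "int mat \<Rightarrow> nat" where
  "int_rank M = vec_space.rank (dim_row M) (map_mat (real_of_int :: int \<Rightarrow> real) M)"

definition subdets :: "int mat \<Rightarrow> nat \<Rightarrow> int set" where
  "subdets M k = {det (submatrix M I J) | I J.
      I \<subseteq> {..<dim_row M} \<and> J \<subseteq> {..<dim_col M} \<and> card I = k \<and> card J = k}"

end

theory Submission
  imports Defs
begin

text \<open>
  Let \<open>L\<close> be the lattice generated by the rows of \<open>A\<^sub>F\<close> and \<open>r\<close> its rank. If the minors of order \<open>r\<close>
  have GCD 1, then every integral vector \<open>w\<close> in the row space lies in \<open>L\<close>, because by Cramer's rule
  the ideal of all \<open>e\<close> with \<open>e w \<in> L\<close> contains every such minor. Conversely, if a prime \<open>l\<close> divides all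
  of them, some integral \<open>w \<notin> L\<close> has \<open>l w \<in> L\<close>.

  GCD condition implies total dual \<open>p\<close>-adicness: given \<open>w\<close>, take a strictly complementary pair \<open>x, y\<close>
  (Fourier-Motzkin elimination with strict inequalities). The tight rows of the face of maximizers of \<open>w\<close>
  are then exactly the support of \<open>y\<close>, so the optimal dual solutions contain a relatively open subset of an
  affine space that has an integral point and a rational direction space. The \<open>p\<close>-adic points are
  dense in such a space.

  Total dual \<open>p\<close>- and \<open>q\<close>-adicness implies the GCD condition: if \<open>l\<close> divides all maximal minors
  of \<open>A\<^sub>F\<close>, one of \<open>p, q\<close> differs from \<open>l\<close>, say \<open>p\<close>. Choose \<open>w \<notin> L\<close> in the cone of \<open>A\<^sub>F\<close> with \<open>l w \<in> L\<close>.
  Optimal dual solutions for \<open>w\<close> are supported on the rows of \<open>A\<^sub>F\<close>, so a \<open>p\<close>-adic one gives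
  \<open>p ^ k w \<in> L\<close>, and Bezout yields \<open>w \<in> L\<close>, a contradiction.
\<close>

section \<open>Minors and rank\<close>

text \<open>Minors are indexed by arbitrary functions instead of sets, so that replacing a row or a column
  needs no reordering and hence no sign.\<close>

definition sel :: "'a mat \<Rightarrow> nat \<Rightarrow> (nat \<Rightarrow> nat) \<Rightarrow> (nat \<Rightarrow> nat) \<Rightarrow> 'a mat" where
  "sel M r f g = mat r r (\<lambda>(i, j). M $$ (f i, g j))"

lemma sel_carrier [simp]: "sel M r f g \<in> carrier_mat r r"
  by (simp add: sel_def)

text \<open>Laplace expansion along column \<open>t\<close>, whose cofactors ignore the replaced
  entries. Hence the entries of the adjugate times the selected rows are again minors, which later
  controls their divisibility.\<close>

lemma det_sel_upd_col:
  fixes M :: "'a :: comm_ring_1 mat"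
  assumes "t < r"
  shows "det (sel M r f (g(t := j))) = (\<Sum>s<r. adj_mat (sel M r f g) $$ (t, s) * M $$ (f s, j))"
proof -
  have "det (sel M r f (g(t := j)))
      = (\<Sum>s<r. sel M r f (g(t := j)) $$ (s, t) * cofactor (sel M r f (g(t := j))) s t)"
    by (rule laplace_expansion_column) (use assms in auto)
  also have "\<dots> = (\<Sum>s<r. adj_mat (sel M r f g) $$ (t, s) * M $$ (f s, j))"
  proof (rule sum.cong[OF refl])
    fix s assume s: "s \<in> {..<r}"
    have "mat_delete (sel M r f (g(t := j))) s t = mat_delete (sel M r f g) s t"
      using s assms by (intro eq_matI) (auto simp: mat_delete_def sel_def)
    then show "sel M r f (g(t := j)) $$ (s, t) * cofactor (sel M r f (g(t := j))) s t
        = adj_mat (sel M r f g) $$ (t, s) * M $$ (f s, j)"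
      using s assms by (simp add: adj_mat_def cofactor_def sel_def)
  qed
  finally show ?thesis .
qed

lemma det_sel_upd_row:
  fixes M :: "'a :: comm_ring_1 mat"
  assumes "s < r"
  shows "det (sel M r (f(s := i)) g) = (\<Sum>t<r. M $$ (i, g t) * adj_mat (sel M r f g) $$ (t, s))"
proof -
  have "det (sel M r (f(s := i)) g)
      = (\<Sum>t<r. sel M r (f(s := i)) g $$ (s, t) * cofactor (sel M r (f(s := i)) g) s t)"
    by (rule laplace_expansion_row) (use assms in auto)
  also have "\<dots> = (\<Sum>t<r. M $$ (i, g t) * adj_mat (sel M r f g) $$ (t, s))"
  proof (rule sum.cong[OF refl])
    fix t assume t: "t \<in> {..<r}"
    have "mat_delete (sel M r (f(s := i)) g) s t = mat_delete (sel M r f g) s t"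
      using t assms by (intro eq_matI) (auto simp: mat_delete_def sel_def)
    then show "sel M r (f(s := i)) g $$ (s, t) * cofactor (sel M r (f(s := i)) g) s t
        = M $$ (i, g t) * adj_mat (sel M r f g) $$ (t, s)"
      using t assms by (simp add: adj_mat_def cofactor_def sel_def)
  qed
  finally show ?thesis .
qed

text \<open>Schur complement formula with the adjugate in place of the inverse, so that it makes
  sense over an integral domain.\<close>

lemma det_sel_bordered:
  fixes M :: "'a :: idom mat"
  assumes "det (sel M r f g) \<noteq> 0"
  shows "det (sel M (Suc r) (f(r := i)) (g(r := j))) = det (sel M r f g) * M $$ (i, j)
    - (\<Sum>t<r. M $$ (i, g t) * (\<Sum>s<r. adj_mat (sel M r f g) $$ (t, s) * M $$ (f s, j)))"
proof -
  define N where "N = sel M r f g"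
  define d where "d = det N"
  define u where "u = mat r 1 (\<lambda>(s, _). M $$ (f s, j))"
  define v where "v = mat 1 r (\<lambda>(_, t). M $$ (i, g t))"
  define a where "a = mat 1 1 (\<lambda>_. M $$ (i, j))"
  define B where "B = four_block_mat N u v a"
  define X where "X = adj_mat N"
  \<comment> \<open>Right multiplication by \<open>Q\<close> scales the last column by
    \<open>d\<close> and subtracts the first \<open>r\<close> columns with coefficients
    \<open>X * u\<close>. This clears \<open>u\<close>, as \<open>N * X\<close> is \<open>d\<close>
    times the identity, and \<open>det Q = d\<close> cancels at the end.\<close>
  define Q where "Q = four_block_mat (1\<^sub>m r) (- (X * u)) (0\<^sub>m 1 r) (d \<cdot>\<^sub>m 1\<^sub>m 1)"
  have c: "N \<in> carrier_mat r r" "u \<in> carrier_mat r 1" "v \<in> carrier_mat 1 r" "a \<in> carrier_mat 1 1"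
    "X \<in> carrier_mat r r"
    using adj_mat(1)[of N r] by (auto simp: N_def u_def v_def a_def X_def)
  have B: "sel M (Suc r) (f(r := i)) (g(r := j)) = B"
    using c by (intro eq_matI) (auto simp: B_def N_def u_def v_def a_def sel_def)
  have NX: "N * X = d \<cdot>\<^sub>m 1\<^sub>m r"
    using adj_mat(2)[OF c(1)] by (simp add: X_def d_def)
  have "N * (- (X * u)) + u * (d \<cdot>\<^sub>m 1\<^sub>m 1) = 0\<^sub>m r 1"
  proof -
    have "N * (X * u) = d \<cdot>\<^sub>m u"
      using c NX by (simp add: assoc_mult_mat[OF c(1) c(5) c(2), symmetric] mult_smult_assoc_mat[of _ r r _ 1])
    moreover have "u * (d \<cdot>\<^sub>m 1\<^sub>m 1) = d \<cdot>\<^sub>m u"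
      using c by (simp add: mult_smult_distrib[of _ r 1 _ 1])
    moreover have "N * (- (X * u)) = - (N * (X * u))"
      using c by (intro uminus_mult_right_mat) auto
    ultimately show ?thesis using c by auto
  qed
  then have BQ: "B * Q = four_block_mat N (0\<^sub>m r 1) v (v * (- (X * u)) + a * (d \<cdot>\<^sub>m 1\<^sub>m 1))"
    unfolding B_def Q_def
    by (subst mult_four_block_mat[where ?nr1.0 = r and ?n1.0 = r and ?n2.0 = 1 and ?nc1.0 = r and ?nc2.0 = 1])
      (use c in \<open>auto\<close>)
  have "det (B * Q) = d * det (v * (- (X * u)) + a * (d \<cdot>\<^sub>m 1\<^sub>m 1))"
    unfolding BQ d_def by (rule det_four_block_mat_upper_right_zero) (use c in auto)
  also have "det (v * (- (X * u)) + a * (d \<cdot>\<^sub>m 1\<^sub>m 1))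
      = (v * (- (X * u)) + a * (d \<cdot>\<^sub>m 1\<^sub>m 1)) $$ (0, 0)"
    using c by (simp add: det_single)
  also have "\<dots> = d * M $$ (i, j) - (\<Sum>t<r. M $$ (i, g t) * (\<Sum>s<r. X $$ (t, s) * M $$ (f s, j)))"
    using c by (auto simp: scalar_prod_def u_def v_def a_def sum_negf lessThan_atLeast0)
  finally have 1: "det (B * Q)
    = d * (d * M $$ (i, j) - (\<Sum>t<r. M $$ (i, g t) * (\<Sum>s<r. X $$ (t, s) * M $$ (f s, j))))" .
  have "det Q = d"
    unfolding Q_def
    by (subst det_four_block_mat_lower_left_zero[where n = r and m = 1]) (use c in auto)
  then have "det (B * Q) = det B * d"
    by (subst det_mult[where n = "Suc r"]) (use c in \<open>auto simp: B_def Q_def\<close>)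
  with 1 assms show ?thesis
    unfolding B by (auto simp: d_def N_def X_def)
qed

section \<open>Minors indexed by functions and by sets\<close>

lemma det_sel_not_inj:
  fixes M :: "'a :: comm_ring_1 mat"
  assumes "\<not> inj_on f {..<r} \<or> \<not> inj_on g {..<r}"
  shows "det (sel M r f g) = 0"
  using assms
proof
  assume "\<not> inj_on f {..<r}"
  then obtain i j where "i < r" "j < r" "i \<noteq> j" "f i = f j"
    by (auto simp: inj_on_def)
  then show ?thesis
    by (intro det_identical_rows[of _ r i j]) (auto simp: sel_def)
next
  assume "\<not> inj_on g {..<r}"
  then obtain i j where "i < r" "j < r" "i \<noteq> j" "g i = g j"
    by (auto simp: inj_on_def)
  then show ?thesis
    by (intro det_identical_columns[of _ r i j]) (auto simp: sel_def)
qed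

lemma bij_betw_pick:
  assumes "finite I"
  shows "bij_betw (pick I) {..<card I} I"
proof -
  have "inj_on (pick I) {..<card I}"
    by (rule linorder_inj_onI) (use pick_mono_le in \<open>fastforce+\<close>)
  moreover have "pick I ` {..<card I} \<subseteq> I"
    by (auto simp: pick_in_set_le)
  ultimately show ?thesis
    by (metis assms bij_betw_def card_image card_lessThan card_subset_eq)
qed

lemma submatrix_eq_sel:
  assumes "I \<subseteq> {..<dim_row M}" "J \<subseteq> {..<dim_col M}" "card I = r" "card J = r"
  shows "submatrix M I J = sel M r (pick I) (pick J)"
proof -
  have "{i. i < dim_row M \<and> i \<in> I} = I" "{j. j < dim_col M \<and> j \<in> J} = J"
    using assms by auto
  then show ?thesis
    using assms by (simp add: submatrix_def sel_def)
qed

lemma inj_on_obtain_permutes_pick: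
  assumes "inj_on f {..<r}"
  obtains p where "p permutes {0..<r}" "\<And>i. i < r \<Longrightarrow> f i = pick (f ` {..<r}) (p i)"
proof -
  define I where "I = f ` {..<r}"
  have I: "finite I" "card I = r"
    using assms by (auto simp: I_def card_image)
  define p where "p i = (if i < r then inv_into {..<r} (pick I) (f i) else i)" for i
  have bp: "bij_betw (pick I) {..<r} I"
    using bij_betw_pick[OF I(1)] I by simp
  have "bij_betw f {..<r} I"
    using assms by (simp add: I_def bij_betw_def)
  then have "bij_betw (inv_into {..<r} (pick I) \<circ> f) {..<r} {..<r}"
    using bij_betw_inv_into[OF bp] bij_betw_trans by blast
  then have "bij_betw p {..<r} {..<r}"
    by (subst bij_betw_cong[of _ _ "inv_into {..<r} (pick I) \<circ> f"]) (auto simp: p_def)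
  then have "p permutes {0..<r}"
    by (intro bij_imp_permutes) (auto simp: p_def atLeast0LessThan)
  moreover have "f i = pick I (p i)" if "i < r" for i
    using that bp by (simp add: p_def I_def bij_betw_def f_inv_into_f)
  ultimately show ?thesis using that unfolding I_def by blast
qed

text \<open>Sorting the chosen rows and columns into increasing order permutes both and costs only
  signs. This links index functions with the index sets in \<open>subdets\<close>.\<close>

lemma det_sel_eq_submatrix:
  fixes M :: "'a :: comm_ring_1 mat"
  assumes "inj_on f {..<r}" "inj_on g {..<r}"
    and "f ` {..<r} \<subseteq> {..<dim_row M}" "g ` {..<r} \<subseteq> {..<dim_col M}"
  shows "\<exists>e. (e = 1 \<or> e = -1) \<and>
    det (sel M r f g) = e * det (submatrix M (f ` {..<r}) (g ` {..<r}))"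
proof -
  let ?I = "f ` {..<r}" and ?J = "g ` {..<r}"
  obtain p where p: "p permutes {0..<r}" "\<And>i. i < r \<Longrightarrow> f i = pick ?I (p i)"
    using inj_on_obtain_permutes_pick[OF assms(1)] by blast
  obtain q where q: "q permutes {0..<r}" "\<And>i. i < r \<Longrightarrow> g i = pick ?J (q i)"
    using inj_on_obtain_permutes_pick[OF assms(2)] by blast
  let ?N = "sel M r (pick ?I) (pick ?J)"
  let ?N' = "sel M r (pick ?I) g"
  have pr: "p i < r" "q i < r" if "i < r" for i
    using that permutes_in_image[OF p(1), of i] permutes_in_image[OF q(1), of i] by auto
  have "sel M r f g = mat r r (\<lambda>(i, j). ?N' $$ (p i, j))"
    using p(2) pr by (intro eq_matI) (auto simp: sel_def)
  then have 1: "det (sel M r f g) = signof p * det ?N'"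
    using det_permute_rows[OF _ p(1), of ?N'] by simp
  have "transpose_mat ?N' = mat r r (\<lambda>(i, j). transpose_mat ?N $$ (q i, j))"
    using q(2) pr by (intro eq_matI) (auto simp: sel_def)
  then have "det (transpose_mat ?N') = signof q * det (transpose_mat ?N)"
    using det_permute_rows[OF _ q(1), of "transpose_mat ?N"] by simp
  then have 2: "det ?N' = signof q * det ?N"
    by (simp add: det_transpose[of _ r])
  have "submatrix M ?I ?J = ?N"
    using assms by (intro submatrix_eq_sel) (auto simp: card_image)
  then have "det (sel M r f g) = (signof p * signof q) * det (submatrix M ?I ?J)"
    using 1 2 by (simp add: mult.assoc)
  moreover have "signof p * signof q = (1::'a) \<or> signof p * signof q = (-1::'a)"
    by (auto simp: sign_def)
  ultimately show ?thesis by blast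
qed

text \<open>Repeated indices give determinant 0 and distinct ones a member of \<open>subdets\<close>
  up to sign.\<close>

lemma Gcd_subdets_dvd_det_sel:
  assumes "f ` {..<r} \<subseteq> {..<dim_row M}" "g ` {..<r} \<subseteq> {..<dim_col M}"
  shows "Gcd (subdets M r) dvd det (sel M r f g)"
proof (cases "inj_on f {..<r} \<and> inj_on g {..<r}")
  case True
  then obtain e where e: "det (sel M r f g) = e * det (submatrix M (f ` {..<r}) (g ` {..<r}))"
    using det_sel_eq_submatrix[OF _ _ assms] by blast
  have "det (submatrix M (f ` {..<r}) (g ` {..<r})) \<in> subdets M r"
    using True assms unfolding subdets_def
    by (intro CollectI exI[of _ "f ` {..<r}"] exI[of _ "g ` {..<r}"]) (simp add: card_image)
  then show ?thesis
    unfolding e by (simp add: Gcd_dvd)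
next
  case False
  then show ?thesis by (simp add: det_sel_not_inj)
qed

lemma subdets_eq_det_sel:
  assumes "x \<in> subdets M r"
  obtains f g where "f ` {..<r} \<subseteq> {..<dim_row M}" "g ` {..<r} \<subseteq> {..<dim_col M}"
    "x = det (sel M r f g)"
proof -
  obtain I J where IJ: "x = det (submatrix M I J)" "I \<subseteq> {..<dim_row M}" "J \<subseteq> {..<dim_col M}"
      "card I = r" "card J = r"
    using assms unfolding subdets_def by blast
  then have "finite I" "finite J"
    using finite_subset by auto
  then have "pick I ` {..<r} \<subseteq> {..<dim_row M}" "pick J ` {..<r} \<subseteq> {..<dim_col M}"
    using bij_betw_pick[of I] bij_betw_pick[of J] IJ by (auto simp: bij_betw_def)
  then show ?thesis
    using IJ that submatrix_eq_sel by metis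
qed

section \<open>Rank and minors of maximal order\<close>

lemma (in vec_space) rank_mult_le:
  assumes A: "A \<in> carrier_mat n k" and B: "B \<in> carrier_mat k nc"
  shows "rank (A * B) \<le> k"
proof -
  have AB: "A * B \<in> carrier_mat n nc" using A B by simp
  have cA: "set (cols A) \<subseteq> carrier_vec n" and cAB: "set (cols (A * B)) \<subseteq> carrier_vec n"
    using cols_dim[of A] cols_dim[of "A * B"] A AB by auto
  have "set (cols (A * B)) \<subseteq> span (set (cols A))"
  proof
    fix x assume "x \<in> set (cols (A * B))"
    then obtain j where j: "j < nc" "x = col (A * B) j"
      using AB by (auto simp: cols_def)
    then have "x = A *\<^sub>v col B j"
      using A B by (intro eq_vecI) auto
    then have "x \<in> col_space A"
      using A B j AB by (subst col_space_eq[OF A]) auto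
    then show "x \<in> span (set (cols A))"
      by (simp add: col_space_def)
  qed
  then have sub: "span (set (cols (A * B))) \<subseteq> span (set (cols A))"
    using cA by (simp add: span_is_subset span_is_submodule)
  have s1: "VectorSpace.subspace class_ring (span (set (cols A))) V"
    and s2: "VectorSpace.subspace class_ring (span (set (cols (A * B)))) V"
    using cA cAB span_is_subspace by auto
  have "rank (A * B) \<le> rank A"
    unfolding rank_def
    using vectorspace.subspace_dim[OF subspace_is_vs[OF s1] nested_subspaces[OF s1 s2 sub]]
      fin_dim_span_cols[OF A] fin_dim_span_cols[OF AB] by auto
  also have "\<dots> \<le> k" by (rule rank_le_nc[OF A])
  finally show ?thesis .
qed

lemma order_le_int_rank:
  assumes "det (sel M s f g) \<noteq> 0" "f ` {..<s} \<subseteq> {..<dim_row M}" "g ` {..<s} \<subseteq> {..<dim_col M}"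
  shows "s \<le> int_rank M"
proof -
  let ?M = "map_mat (real_of_int) M"
  have inj: "inj_on f {..<s}" "inj_on g {..<s}"
    using assms(1) det_sel_not_inj by blast+
  have "sel ?M s f g = map_mat real_of_int (sel M s f g)"
    using assms(2,3) by (intro eq_matI) (auto simp: sel_def image_subset_iff)
  then have "det (sel ?M s f g) \<noteq> 0"
    using assms(1) by (simp add: of_int_hom.hom_det)
  then have "det (submatrix ?M (f ` {..<s}) (g ` {..<s})) \<noteq> 0"
    using det_sel_eq_submatrix[OF inj, of ?M] assms(2,3) by fastforce
  then have "card {j. j < dim_col M \<and> j \<in> g ` {..<s}} \<le> int_rank M"
    unfolding int_rank_def by (intro vec_space.rank_gt_minor) auto
  moreover have "{j. j < dim_col M \<and> j \<in> g ` {..<s}} = g ` {..<s}"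
    using assms(3) by auto
  ultimately show ?thesis
    using inj by (simp add: card_image)
qed

text \<open>The bordered minors vanish, hence so does the Schur complement of the minor
  \<open>d\<close>. Thus \<open>d M\<close> is the product of the columns \<open>g\<close>, the
  adjugate and the rows \<open>f\<close>: a rank factorization with denominators cleared.\<close>

lemma factor_through_minor:
  fixes M :: "'a :: idom mat"
  assumes "det (sel M r f g) \<noteq> 0" "f ` {..<r} \<subseteq> {..<dim_row M}" "g ` {..<r} \<subseteq> {..<dim_col M}"
    and "\<And>f g. f ` {..<Suc r} \<subseteq> {..<dim_row M} \<Longrightarrow> g ` {..<Suc r} \<subseteq> {..<dim_col M} \<Longrightarrow>
      det (sel M (Suc r) f g) = 0"
    and "i < dim_row M" "j < dim_col M"
  shows "det (sel M r f g) * M $$ (i, j) =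
    (\<Sum>t<r. M $$ (i, g t) * (\<Sum>s<r. adj_mat (sel M r f g) $$ (t, s) * M $$ (f s, j)))"
proof -
  have "det (sel M (Suc r) (f(r := i)) (g(r := j))) = 0"
    using assms(2,3,5,6) by (intro assms(4)) (auto simp: less_Suc_eq image_subset_iff)
  then show ?thesis
    unfolding det_sel_bordered[OF assms(1)] by simp
qed

text \<open>Nonzero minors have order at most the rank. For the largest such order \<open>s\<close>
  the bordered minors vanish, so \<open>M\<close> factors through dimension \<open>s\<close> and its
  rank is at most \<open>s\<close>.\<close>

lemma ex_det_sel_int_rank_nonzero:
  obtains f g where "det (sel M (int_rank M) f g) \<noteq> 0"
    "f ` {..<int_rank M} \<subseteq> {..<dim_row M}" "g ` {..<int_rank M} \<subseteq> {..<dim_col M}"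
proof -
  define P where "P s \<longleftrightarrow> (\<exists>f g. det (sel M s f g) \<noteq> 0 \<and>
      f ` {..<s} \<subseteq> {..<dim_row M} \<and> g ` {..<s} \<subseteq> {..<dim_col M})" for s
  \<comment> \<open>The empty minor has determinant 1, so a greatest order exists.\<close>
  have "P 0" by (simp add: P_def sel_def)
  have bd: "P s \<Longrightarrow> s \<le> int_rank M" for s
    unfolding P_def using order_le_int_rank by blast
  define s where "s = (GREATEST s. P s)"
  have "P s"
    unfolding s_def using \<open>P 0\<close> bd by (rule GreatestI_nat)
  have "\<not> P (Suc s)"
    using Greatest_le_nat[of P "Suc s" "int_rank M"] bd unfolding s_def by auto
  obtain f g where fg: "det (sel M s f g) \<noteq> 0" "f ` {..<s} \<subseteq> {..<dim_row M}" "g ` {..<s} \<subseteq> {..<dim_col M}"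
    using \<open>P s\<close> unfolding P_def by blast
  let ?d = "det (sel M s f g)"
  let ?M = "map_mat real_of_int M"
  define C where "C = mat (dim_row M) s (\<lambda>(i, t). real_of_int (M $$ (i, g t)))"
  define D where "D = mat s (dim_col M)
    (\<lambda>(t, j). (\<Sum>k<s. real_of_int (adj_mat (sel M s f g) $$ (t, k) * M $$ (f k, j))) / ?d)"
  have "?M = C * D"
  proof (rule eq_matI)
    fix i j assume "i < dim_row (C * D)" "j < dim_col (C * D)"
    then have ij: "i < dim_row M" "j < dim_col M" by (auto simp: C_def D_def)
    have "?d * M $$ (i, j) =
        (\<Sum>t<s. M $$ (i, g t) * (\<Sum>k<s. adj_mat (sel M s f g) $$ (t, k) * M $$ (f k, j)))"
      by (rule factor_through_minor) (use fg ij \<open>\<not> P (Suc s)\<close> in \<open>unfold P_def, blast+\<close>)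
    then have "real_of_int (?d * M $$ (i, j)) = real_of_int
        (\<Sum>t<s. M $$ (i, g t) * (\<Sum>k<s. adj_mat (sel M s f g) $$ (t, k) * M $$ (f k, j)))"
      by (rule arg_cong)
    then show "?M $$ (i, j) = (C * D) $$ (i, j)"
      using ij fg(1)
      by (simp add: C_def D_def scalar_prod_def lessThan_atLeast0 sum_divide_distrib[symmetric]
          field_simps)
  qed (auto simp: C_def D_def)
  moreover have "vec_space.rank (dim_row M) (C * D) \<le> s"
    by (rule vec_space.rank_mult_le) (auto simp: C_def D_def)
  ultimately have "int_rank M \<le> s"
    by (simp add: int_rank_def)
  with bd[OF \<open>P s\<close>] have "s = int_rank M" by simp
  with fg that show ?thesis by blast
qed

lemma factor_through_max_minor:
  assumes "det (sel M (int_rank M) f g) \<noteq> 0" "r = int_rank M"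
    and "f ` {..<r} \<subseteq> {..<dim_row M}" "g ` {..<r} \<subseteq> {..<dim_col M}"
    and "i < dim_row M" "j < dim_col M"
  shows "det (sel M r f g) * M $$ (i, j) =
    (\<Sum>t<r. M $$ (i, g t) * (\<Sum>s<r. adj_mat (sel M r f g) $$ (t, s) * M $$ (f s, j)))"
proof (rule factor_through_minor)
  fix f g assume "f ` {..<Suc r} \<subseteq> {..<dim_row M}" "g ` {..<Suc r} \<subseteq> {..<dim_col M}"
  then show "det (sel M (Suc r) f g) = 0"
    using order_le_int_rank[of M "Suc r" f g] assms(2) by fastforce
qed (use assms in auto)

section \<open>The row lattice\<close>

text \<open>Turns coefficients on the rows chosen by \<open>f\<close> into coefficients on all rows;
  those of a row chosen repeatedly add up.\<close>

lemma sum_scatter: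
  fixes c :: "nat \<Rightarrow> 'a :: comm_semiring_0" and f :: "nat \<Rightarrow> nat"
  assumes "f ` {..<r} \<subseteq> {..<m}"
  shows "(\<Sum>i<m. (\<Sum>s<r. if f s = i then c s else 0) * h i) = (\<Sum>s<r. c s * h (f s))"
proof -
  have "(\<Sum>i<m. (\<Sum>s<r. if f s = i then c s else 0) * h i)
      = (\<Sum>s<r. \<Sum>i<m. if f s = i then c s * h i else 0)"
    by (subst sum.swap) (auto simp: sum_distrib_right intro!: sum.cong)
  also have "\<dots> = (\<Sum>s<r. c s * h (f s))"
  proof (rule sum.cong[OF refl])
    fix s assume "s \<in> {..<r}"
    then have "f s < m" using assms by auto
    then show "(\<Sum>i<m. if f s = i then c s * h i else 0) = c s * h (f s)"
      by simp
  qed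
  finally show ?thesis .
qed

text \<open>Division with remainder shows that the least positive element of the ideal
  \<open>E\<close> divides all of \<open>S\<close>, hence also \<open>Gcd S\<close>, which is thus
  one of its multiples.\<close>

lemma Gcd_in_int_ideal:
  fixes E :: "int set"
  assumes "0 \<in> E" "\<And>x y. x \<in> E \<Longrightarrow> y \<in> E \<Longrightarrow> x + y \<in> E" "\<And>x k. x \<in> E \<Longrightarrow> k * x \<in> E"
    and "S \<subseteq> E"
  shows "Gcd S \<in> E"
proof (cases "S \<subseteq> {0}")
  case True
  then show ?thesis using assms(1) by (metis Gcd_0_iff)
next
  case False
  then obtain x where x: "x \<in> E" "x \<noteq> 0" using assms(4) by blast
  have "\<bar>x\<bar> \<in> E"
    using assms(3)[OF x(1), of "sgn x"] by (simp add: abs_sgn mult.commute)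
  then have "int (nat \<bar>x\<bar>) \<in> E \<and> 0 < nat \<bar>x\<bar>"
    using x by simp
  then have ex: "\<exists>n. int n \<in> E \<and> 0 < n" by blast
  define n where "n = (LEAST n. int n \<in> E \<and> 0 < n)"
  have n: "int n \<in> E" "0 < n"
    using LeastI_ex[OF ex] by (auto simp: n_def)
  have "int n dvd y" if y: "y \<in> S" for y
  proof (rule ccontr)
    assume "\<not> int n dvd y"
    then have "0 < y mod int n" using n(2) by (simp add: mod_int_pos_iff dvd_eq_mod_eq_0 order.not_eq_order_implies_strict)
    moreover have "y mod int n < int n" using n(2) by simp
    moreover have "y mod int n = y + (- (y div int n)) * int n"
      by (simp add: minus_div_mult_eq_mod[symmetric])
    then have "y mod int n \<in> E"
      using assms(2)[OF _ assms(3)[OF n(1), of "- (y div int n)"], of y] y assms(4) by (simp add: subset_iff)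
    ultimately have "int (nat (y mod int n)) \<in> E \<and> 0 < nat (y mod int n)" "nat (y mod int n) < n"
      by auto
    then show False unfolding n_def using not_less_Least by blast
  qed
  then have "int n dvd Gcd S" by (rule Gcd_greatest)
  then show ?thesis using assms(3)[OF n(1)] by (auto simp: dvd_def mult.commute)
qed

text \<open>Multiplying the factorization of \<open>d M\<close> by the real solution
  \<open>y\<close> turns \<open>y M\<close> on the columns \<open>g\<close> into entries of
  \<open>w\<close>. So \<open>y\<close> drops out and \<open>d w\<close> is an integral combination
  of the rows \<open>f\<close>. Hence all minors of maximal order lie in the ideal \<open>E\<close>,
  and with them their GCD.\<close>

lemma ex_int_solution:
  fixes y :: "nat \<Rightarrow> real" and w :: "nat \<Rightarrow> int"
  assumes gcd: "Gcd (subdets M (int_rank M)) = 1"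
    and y: "\<And>j. j < dim_col M \<Longrightarrow> (\<Sum>i<dim_row M. y i * real_of_int (M $$ (i, j))) = real_of_int (w j)"
  shows "\<exists>z :: nat \<Rightarrow> int. \<forall>j<dim_col M. (\<Sum>i<dim_row M. z i * M $$ (i, j)) = w j"
proof -
  define r where "r = int_rank M"
  define E where "E = {e. \<exists>z :: nat \<Rightarrow> int. \<forall>j<dim_col M. (\<Sum>i<dim_row M. z i * M $$ (i, j)) = e * w j}"
  have "subdets M r \<subseteq> E"
  proof
    fix x assume "x \<in> subdets M r"
    then obtain f g where fg: "f ` {..<r} \<subseteq> {..<dim_row M}" "g ` {..<r} \<subseteq> {..<dim_col M}"
        "x = det (sel M r f g)"
      by (rule subdets_eq_det_sel)
    show "x \<in> E"
    proof (cases "x = 0")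
      case True
      then show ?thesis by (auto simp: E_def intro!: exI[of _ "\<lambda>_. 0"])
    next
      case False
      define X where "X = adj_mat (sel M r f g)"
      define D where "D t j = (\<Sum>s<r. X $$ (t, s) * M $$ (f s, j))" for t j
      define c where "c s = (\<Sum>t<r. w (g t) * X $$ (t, s))" for s
      have "(\<Sum>i<dim_row M. (\<Sum>s<r. if f s = i then c s else 0) * M $$ (i, j)) = x * w j"
        if j: "j < dim_col M" for j
      proof -
        have "real_of_int (x * w j) = (\<Sum>i<dim_row M. y i * real_of_int (x * M $$ (i, j)))"
          by (simp add: y[OF j, symmetric] sum_distrib_left mult_ac)
        also have "\<dots> = (\<Sum>i<dim_row M. y i * real_of_int (\<Sum>t<r. M $$ (i, g t) * D t j))"
          using factor_through_max_minor[of M f g r _ j] False fg j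
          by (intro sum.cong refl) (simp add: X_def D_def r_def)
        also have "\<dots> = (\<Sum>t<r. (\<Sum>i<dim_row M. y i * M $$ (i, g t)) * real_of_int (D t j))"
          unfolding of_int_sum sum_distrib_left sum_distrib_right
          by (subst sum.swap) (simp add: mult_ac)
        also have "\<dots> = (\<Sum>t<r. real_of_int (w (g t)) * real_of_int (D t j))"
          using y fg(2) by (intro sum.cong refl) (simp add: image_subset_iff)
        also have "\<dots> = real_of_int (\<Sum>t<r. \<Sum>s<r. w (g t) * X $$ (t, s) * M $$ (f s, j))"
          by (simp add: D_def sum_distrib_left mult_ac)
        also have "(\<Sum>t<r. \<Sum>s<r. w (g t) * X $$ (t, s) * M $$ (f s, j)) = (\<Sum>s<r. c s * M $$ (f s, j))"
          by (subst sum.swap) (simp add: c_def sum_distrib_right)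
        finally have "x * w j = (\<Sum>s<r. c s * M $$ (f s, j))"
          by (simp only: of_int_eq_iff)
        then show ?thesis
          by (simp add: sum_scatter[OF fg(1)])
      qed
      then show ?thesis
        unfolding E_def by (intro CollectI exI[of _ "\<lambda>i. \<Sum>s<r. if f s = i then c s else 0"]) simp
    qed
  qed
  moreover have "0 \<in> E"
    by (auto simp: E_def intro!: exI[of _ "\<lambda>_. 0"])
  moreover have "x + x' \<in> E" if "x \<in> E" "x' \<in> E" for x x'
  proof -
    obtain z z' where "\<forall>j<dim_col M. (\<Sum>i<dim_row M. z i * M $$ (i, j)) = x * w j"
      "\<forall>j<dim_col M. (\<Sum>i<dim_row M. z' i * M $$ (i, j)) = x' * w j"
      using \<open>x \<in> E\<close> \<open>x' \<in> E\<close> by (auto simp: E_def)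
    then show ?thesis
      by (auto simp: E_def distrib_right sum.distrib intro!: exI[of _ "\<lambda>i. z i + z' i"])
  qed
  moreover have "k * x \<in> E" if "x \<in> E" for x k
  proof -
    obtain z where "\<forall>j<dim_col M. (\<Sum>i<dim_row M. z i * M $$ (i, j)) = x * w j"
      using \<open>x \<in> E\<close> by (auto simp: E_def)
    then show ?thesis
      by (auto simp: E_def mult.assoc sum_distrib_left[symmetric] intro!: exI[of _ "\<lambda>i. k * z i"])
  qed
  ultimately have "Gcd (subdets M r) \<in> E"
    using Gcd_in_int_ideal by blast
  then show ?thesis
    using gcd by (simp add: E_def r_def)
qed

text \<open>\<open>P / d\<close> is a projection onto the left kernel with rational entries; it transports density of
  the \<open>p\<close>-adic rationals to the kernel.\<close>

lemma ex_projection_onto_left_kernel: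
  fixes M :: "int mat"
  shows "\<exists>(d :: int) (P :: nat \<Rightarrow> nat \<Rightarrow> int). d \<noteq> 0 \<and>
    (\<forall>v :: nat \<Rightarrow> real. \<forall>j<dim_col M.
      (\<Sum>i<dim_row M. (\<Sum>k<dim_row M. v k * real_of_int (P k i)) * real_of_int (M $$ (i, j))) = 0) \<and>
    (\<forall>v :: nat \<Rightarrow> real.
      (\<forall>j<dim_col M. (\<Sum>i<dim_row M. v i * real_of_int (M $$ (i, j))) = 0) \<longrightarrow>
      (\<forall>i<dim_row M. (\<Sum>k<dim_row M. v k * real_of_int (P k i)) = real_of_int d * v i))"
proof -
  define r where "r = int_rank M"
  obtain f g where fg: "det (sel M r f g) \<noteq> 0"
    "f ` {..<r} \<subseteq> {..<dim_row M}" "g ` {..<r} \<subseteq> {..<dim_col M}"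
    using ex_det_sel_int_rank_nonzero unfolding r_def by metis
  define d where "d = det (sel M r f g)"
  define X where "X = adj_mat (sel M r f g)"
  define C where "C k s = (\<Sum>t<r. M $$ (k, g t) * X $$ (t, s))" for k s
  \<comment> \<open>Read as \<open>d v - v C\<close>, with \<open>C\<close> placed on the rows
    \<open>f\<close>. It lands in the kernel because \<open>C\<close> times the rows
    \<open>f\<close> is \<open>d M\<close>. On the kernel it is multiplication by \<open>d\<close>:
    there \<open>v C = 0\<close>, since \<open>C\<close> is built from columns of
    \<open>M\<close>.\<close>
  define P where "P k i = (if k = i then d else 0) - (\<Sum>s<r. if f s = i then C k s else 0)" for k i
  have C: "(\<Sum>s<r. C k s * M $$ (f s, j)) = d * M $$ (k, j)"
    if "k < dim_row M" "j < dim_col M" for k j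
  proof -
    have "(\<Sum>s<r. C k s * M $$ (f s, j)) = (\<Sum>t<r. M $$ (k, g t) * (\<Sum>s<r. X $$ (t, s) * M $$ (f s, j)))"
      unfolding C_def sum_distrib_right sum_distrib_left
      by (subst sum.swap) (simp add: mult_ac)
    then show ?thesis
      using factor_through_max_minor[of M f g r k j] fg that by (simp add: X_def d_def r_def)
  qed
  have PM: "(\<Sum>i<dim_row M. P k i * M $$ (i, j)) = 0" if "k < dim_row M" "j < dim_col M" for k j
  proof -
    have "(\<Sum>i<dim_row M. P k i * M $$ (i, j)) = (\<Sum>i<dim_row M. if k = i then d * M $$ (i, j) else 0)
      - (\<Sum>i<dim_row M. (\<Sum>s<r. if f s = i then C k s else 0) * M $$ (i, j))"
      unfolding P_def left_diff_distrib sum_subtractf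
      by (intro arg_cong2[of _ _ _ _ "(-)"] sum.cong) auto
    also have "\<dots> = 0"
      using that by (simp add: sum_scatter[OF fg(2)] C)
    finally show ?thesis .
  qed
  have "d \<noteq> 0" using fg by (simp add: d_def)
  moreover have "(\<Sum>i<dim_row M. (\<Sum>k<dim_row M. v k * real_of_int (P k i)) * real_of_int (M $$ (i, j))) = 0"
    if j: "j < dim_col M" for v :: "nat \<Rightarrow> real" and j
  proof -
    have "(\<Sum>i<dim_row M. (\<Sum>k<dim_row M. v k * real_of_int (P k i)) * real_of_int (M $$ (i, j)))
      = (\<Sum>k<dim_row M. v k * real_of_int (\<Sum>i<dim_row M. P k i * M $$ (i, j)))"
      unfolding sum_distrib_right of_int_sum sum_distrib_left
      by (subst sum.swap) (simp add: mult_ac)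
    then show ?thesis
      using PM j by simp
  qed
  moreover have "(\<Sum>k<dim_row M. v k * real_of_int (P k i)) = d * v i"
    if v: "\<And>j. j < dim_col M \<Longrightarrow> (\<Sum>i<dim_row M. v i * real_of_int (M $$ (i, j))) = 0"
      and i: "i < dim_row M" for v :: "nat \<Rightarrow> real" and i
  proof -
    have vC: "(\<Sum>k<dim_row M. v k * real_of_int (C k s)) = 0" for s
    proof -
      have "(\<Sum>k<dim_row M. v k * real_of_int (C k s))
        = (\<Sum>t<r. (\<Sum>k<dim_row M. v k * real_of_int (M $$ (k, g t))) * X $$ (t, s))"
        unfolding C_def sum_distrib_right of_int_sum sum_distrib_left
        by (subst sum.swap) (simp add: mult_ac)
      also have "\<dots> = 0"
        using v fg(3) by (intro sum.neutral) (simp add: image_subset_iff)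
      finally show ?thesis .
    qed
    have "(\<Sum>k<dim_row M. v k * real_of_int (P k i)) = (\<Sum>k<dim_row M. if k = i then d * v k else 0)
      - (\<Sum>k<dim_row M. \<Sum>s<r. if f s = i then v k * real_of_int (C k s) else 0)"
      unfolding P_def of_int_diff right_diff_distrib sum_subtractf of_int_sum sum_distrib_left
      by (intro arg_cong2[of _ _ _ _ "(-)"] sum.cong) auto
    also have "(\<Sum>k<dim_row M. \<Sum>s<r. if f s = i then v k * real_of_int (C k s) else 0)
      = (\<Sum>s<r. if f s = i then (\<Sum>k<dim_row M. v k * real_of_int (C k s)) else 0)"
      by (subst sum.swap) (auto intro!: sum.cong)
    also have "\<dots> = 0" by (simp add: vC)
    finally show ?thesis
      using i by simp
  qed
  ultimately show ?thesis
    by (intro exI[of _ d] exI[of _ P]) auto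
qed

text \<open>If the row lattice were saturated at \<open>l\<close>, take a nonzero minor \<open>d = det N = l ^ v * e\<close> of order
  \<open>r\<close> whose \<open>l\<close>-multiplicity \<open>v\<close> is minimal. By Cramer's rule \<open>M\<close> factors through \<open>N\<close> with
  coefficients that are again minors, hence divisible by \<open>l ^ v\<close>, and saturation then yields an integral
  \<open>V\<close> with \<open>V N = e\<^sup>2 I\<close>. So \<open>l\<close> does not divide \<open>d\<close>.\<close>

lemma ex_nonsaturated_vector:
  fixes M :: "int mat" and l :: int
  assumes l: "prime l" "l dvd Gcd (subdets M (int_rank M))"
  shows "\<exists>(w :: nat \<Rightarrow> int) (y :: nat \<Rightarrow> int).
    (\<forall>j<dim_col M. (\<Sum>i<dim_row M. y i * M $$ (i, j)) = l * w j) \<and>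
    (\<nexists>z :: nat \<Rightarrow> int. \<forall>j<dim_col M. (\<Sum>i<dim_row M. z i * M $$ (i, j)) = w j)"
proof (rule ccontr)
  let ?n = "dim_col M" and ?m = "dim_row M"
  define r where "r = int_rank M"
  define L where "L w \<longleftrightarrow> (\<exists>z :: nat \<Rightarrow> int. \<forall>j<?n. (\<Sum>i<?m. z i * M $$ (i, j)) = w j)" for w :: "nat \<Rightarrow> int"
  assume "\<not> ?thesis"
  then have sat: "L (\<lambda>j. l * w j) \<Longrightarrow> L w" for w
    unfolding L_def by blast
  have sat_pow: "L (\<lambda>j. l ^ v * w j) \<Longrightarrow> L w" for v w
  proof (induction v arbitrary: w)
    case (Suc v)
    then show ?case using sat[of w] Suc.IH[of "\<lambda>j. l * w j"] by (simp add: mult_ac)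
  qed simp
  define Q where "Q fg \<longleftrightarrow> det (sel M r (fst fg) (snd fg)) \<noteq> 0 \<and> fst fg ` {..<r} \<subseteq> {..<?m} \<and>
    snd fg ` {..<r} \<subseteq> {..<?n}" for fg
  obtain f0 g0 where "Q (f0, g0)"
    using ex_det_sel_int_rank_nonzero[of M] unfolding Q_def r_def by (metis fst_conv snd_conv)
  then obtain fg where fg: "Q fg"
    "\<And>fg'. Q fg' \<Longrightarrow> multiplicity l (det (sel M r (fst fg) (snd fg)))
      \<le> multiplicity l (det (sel M r (fst fg') (snd fg')))"
    using ex_has_least_nat[of Q "(f0, g0)" "\<lambda>fg. multiplicity l (det (sel M r (fst fg) (snd fg)))"]
    by blast
  obtain f g where fg_eq: "fg = (f, g)" by fastforce
  define d where "d = det (sel M r f g)"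
  define v where "v = multiplicity l d"
  define X where "X = adj_mat (sel M r f g)"
  have d0: "d \<noteq> 0" and f: "f ` {..<r} \<subseteq> {..<?m}" and g: "g ` {..<r} \<subseteq> {..<?n}"
    using fg(1) by (auto simp: Q_def fg_eq d_def)
  have lpow: "l ^ v dvd det (sel M r f' g')"
    if "f' ` {..<r} \<subseteq> {..<?m}" "g' ` {..<r} \<subseteq> {..<?n}" for f' g'
  proof (cases "det (sel M r f' g') = 0")
    case False
    then have "v \<le> multiplicity l (det (sel M r f' g'))"
      using fg(2)[of "(f', g')"] that by (simp add: Q_def fg_eq v_def d_def)
    then show ?thesis by (rule multiplicity_dvd')
  qed simp
  obtain e where e: "d = l ^ v * e" "\<not> l dvd e"
    using multiplicity_decompose'[OF d0, of l] l(1) not_prime_unit unfolding v_def by metis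
  have l0: "l \<noteq> 0" using l(1) by auto
  \<comment> \<open>Both divisions are exact: the sums are minors with one column or row exchanged,
    and minimality of \<open>v\<close> makes all of these divisible by \<open>l ^ v\<close>.\<close>
  define D where "D t j = (\<Sum>s<r. X $$ (t, s) * M $$ (f s, j)) div l ^ v" for t j
  define C where "C i s = (\<Sum>t<r. M $$ (i, g t) * X $$ (t, s)) div l ^ v" for i s
  have D: "(\<Sum>s<r. X $$ (t, s) * M $$ (f s, j)) = l ^ v * D t j" if "t < r" "j < ?n" for t j
  proof -
    have "l ^ v dvd det (sel M r f (g(t := j)))"
      using that f g by (intro lpow) (auto simp: image_subset_iff)
    then show ?thesis
      by (simp add: det_sel_upd_col[OF \<open>t < r\<close>] D_def X_def)
  qed
  have C: "(\<Sum>t<r. M $$ (i, g t) * X $$ (t, s)) = l ^ v * C i s" if "s < r" "i < ?m" for i s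
  proof -
    have "l ^ v dvd det (sel M r (f(s := i)) g)"
      using that f g by (intro lpow) (auto simp: image_subset_iff)
    then show ?thesis
      by (simp add: det_sel_upd_row[OF \<open>s < r\<close>] C_def X_def)
  qed
  \<comment> \<open>\<open>l ^ v * D t\<close> is a row of the adjugate times the rows
    \<open>f\<close>, hence in the lattice; saturation removes the power of
    \<open>l\<close>.\<close>
  have "L (D t)" if t: "t < r" for t
  proof (rule sat_pow)
    show "L (\<lambda>j. l ^ v * D t j)"
      unfolding L_def
      by (rule exI[of _ "\<lambda>i. \<Sum>s<r. if f s = i then X $$ (t, s) else 0"])
        (simp add: sum_scatter[OF f] D[OF t])
  qed
  then obtain Y where Y: "\<And>t j. t < r \<Longrightarrow> j < ?n \<Longrightarrow> (\<Sum>i<?m. Y t i * M $$ (i, j)) = D t j"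
    unfolding L_def by metis
  have eM: "e * M $$ (i, j) = (\<Sum>s<r. C i s * M $$ (f s, j))" if "i < ?m" "j < ?n" for i j
  proof -
    have "l ^ v * (e * M $$ (i, j)) = d * M $$ (i, j)" by (simp add: e(1))
    also have "\<dots> = (\<Sum>t<r. M $$ (i, g t) * (\<Sum>s<r. X $$ (t, s) * M $$ (f s, j)))"
      unfolding d_def X_def
      by (rule factor_through_max_minor) (use that f g d0 in \<open>auto simp: d_def r_def\<close>)
    also have "\<dots> = (\<Sum>s<r. (\<Sum>t<r. M $$ (i, g t) * X $$ (t, s)) * M $$ (f s, j))"
      unfolding sum_distrib_left sum_distrib_right by (subst sum.swap) (simp add: mult_ac)
    also have "\<dots> = l ^ v * (\<Sum>s<r. C i s * M $$ (f s, j))"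
      unfolding sum_distrib_left using that by (intro sum.cong refl) (simp add: C mult.assoc)
    finally show ?thesis using l0 by simp
  qed
  \<comment> \<open>As matrices \<open>Y M = D\<close>, and \<open>e M\<close> is \<open>C\<close>
    times the rows \<open>f\<close>. On the columns \<open>g\<close> the matrix \<open>D\<close> is
    \<open>e\<close> times the identity, so \<open>Y C\<close> inverts the selected minor up to the
    factor \<open>e ^ 2\<close>.\<close>
  define V where "V = mat r r (\<lambda>(t, s). \<Sum>i<?m. Y t i * C i s)"
  have "V * sel M r f g = e\<^sup>2 \<cdot>\<^sub>m 1\<^sub>m r"
  proof (rule eq_matI)
    fix t u assume "t < dim_row (e\<^sup>2 \<cdot>\<^sub>m 1\<^sub>m r)" "u < dim_col (e\<^sup>2 \<cdot>\<^sub>m 1\<^sub>m r)"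
    then have tu: "t < r" "u < r" by auto
    then have gu: "g u < ?n" using g by auto
    have "l ^ v * D t (g u) = (X * sel M r f g) $$ (t, u)"
      using tu adj_mat(1)[of "sel M r f g" r]
      by (simp add: D[OF tu(1) gu, symmetric] X_def sel_def scalar_prod_def lessThan_atLeast0)
    also have "\<dots> = l ^ v * (if t = u then e else 0)"
      using tu adj_mat(3)[of "sel M r f g" r] by (simp add: X_def d_def[symmetric] e(1))
    finally have Dg: "D t (g u) = (if t = u then e else 0)" using l0 by simp
    have "(V * sel M r f g) $$ (t, u) = (\<Sum>s<r. (\<Sum>i<?m. Y t i * C i s) * M $$ (f s, g u))"
      using tu by (simp add: V_def sel_def scalar_prod_def lessThan_atLeast0)
    also have "\<dots> = (\<Sum>i<?m. Y t i * (\<Sum>s<r. C i s * M $$ (f s, g u)))"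
      unfolding sum_distrib_left sum_distrib_right by (subst sum.swap) (simp add: mult_ac)
    also have "\<dots> = e * (\<Sum>i<?m. Y t i * M $$ (i, g u))"
      using gu by (simp add: eM[symmetric] sum_distrib_left mult_ac)
    also have "\<dots> = e * D t (g u)" using Y tu gu by simp
    finally show "(V * sel M r f g) $$ (t, u) = (e\<^sup>2 \<cdot>\<^sub>m 1\<^sub>m r) $$ (t, u)"
      using tu by (simp add: Dg power2_eq_square)
  qed (auto simp: V_def sel_def)
  then have "det V * d = (e\<^sup>2) ^ r"
    using det_mult[of V r "sel M r f g"] by (simp add: V_def d_def)
  \<comment> \<open>The hypothesis makes \<open>l\<close> divide \<open>d\<close>, which divides a
    power of \<open>e\<close>; but \<open>e\<close> is prime to \<open>l\<close>.\<close>
  moreover have "l dvd d"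
    unfolding d_def using dvd_trans[OF l(2)] Gcd_subdets_dvd_det_sel[OF f g] by (simp add: r_def)
  ultimately have "l dvd (e\<^sup>2) ^ r"
    by (metis dvd_mult)
  then show False
    using l(1) e(2) prime_dvd_power by blast
qed

section \<open>Linear programming duality\<close>

text \<open>A triple \<open>(a, \<beta>, s)\<close> with \<open>s \<ge> 0\<close> stands for the constraint \<open>a x \<le> \<beta>\<close>, taken strictly
  if \<open>s > 0\<close>; with this encoding strictness is inherited by nonnegative combinations.\<close>

inductive_set cone :: "((nat \<Rightarrow> real) \<times> real \<times> real) set \<Rightarrow> ((nat \<Rightarrow> real) \<times> real \<times> real) set"
  for C where
  base: "c \<in> C \<Longrightarrow> c \<in> cone C"
| add: "(a, \<beta>, s) \<in> cone C \<Longrightarrow> (a', \<beta>', s') \<in> cone C \<Longrightarrow> (\<lambda>j. a j + a' j, \<beta> + \<beta>', s + s') \<in> cone C"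
| scale: "(a, \<beta>, s) \<in> cone C \<Longrightarrow> 0 < k \<Longrightarrow> (\<lambda>j. k * a j, k * \<beta>, k * s) \<in> cone C"

lemma cone_subset:
  assumes "C' \<subseteq> cone C"
  shows "cone C' \<subseteq> cone C"
proof
  fix c assume "c \<in> cone C'"
  then show "c \<in> cone C"
    by induction (use assms in \<open>auto intro: cone.add cone.scale\<close>)
qed

lemma cone_coeff_zero:
  assumes "(a, \<beta>, s) \<in> cone C" "\<And>a \<beta> s. (a, \<beta>, s) \<in> C \<Longrightarrow> a n = 0"
  shows "a n = 0"
  using assms(1) by (induction a \<beta> s rule: cone.induct[split_format(complete)]) (use assms(2) in auto)

lemma cone_nonneg:
  assumes "(a, \<beta>, s) \<in> cone C" "\<And>a \<beta> s. (a, \<beta>, s) \<in> C \<Longrightarrow> 0 \<le> s"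
  shows "0 \<le> s"
  using assms(1) by (induction a \<beta> s rule: cone.induct[split_format(complete)]) (use assms(2) in auto)

text \<open>Recovers the multipliers of a derived constraint; later they are used to modify a dual
  solution.\<close>

lemma cone_image:
  assumes "c \<in> cone ((\<lambda>k. (a k, \<beta> k, s k)) ` K)" "finite K"
  shows "\<exists>z. (\<forall>k\<in>K. 0 \<le> z k) \<and>
    c = (\<lambda>j. \<Sum>k\<in>K. z k * a k j, \<Sum>k\<in>K. z k * \<beta> k, \<Sum>k\<in>K. z k * s k)"
  using assms(1)
proof induction
  case (base c)
  then obtain k where "k \<in> K" "c = (a k, \<beta> k, s k)" by auto
  then show ?case
    using assms(2) by (intro exI[of _ "\<lambda>k'. if k' = k then 1 else 0"]) (simp add: if_distrib[of "\<lambda>x. x * _"] cong: if_cong)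
next
  case (add a1 \<beta>1 s1 a2 \<beta>2 s2)
  then obtain z1 z2 where "\<forall>k\<in>K. 0 \<le> z1 k" "\<forall>k\<in>K. 0 \<le> z2 k"
    "(a1, \<beta>1, s1) = (\<lambda>j. \<Sum>k\<in>K. z1 k * a k j, \<Sum>k\<in>K. z1 k * \<beta> k, \<Sum>k\<in>K. z1 k * s k)"
    "(a2, \<beta>2, s2) = (\<lambda>j. \<Sum>k\<in>K. z2 k * a k j, \<Sum>k\<in>K. z2 k * \<beta> k, \<Sum>k\<in>K. z2 k * s k)"
    by auto
  then show ?case
    by (intro exI[of _ "\<lambda>k. z1 k + z2 k"]) (simp add: distrib_right sum.distrib)
next
  case (scale a1 \<beta>1 s1 q)
  then obtain z1 where "\<forall>k\<in>K. 0 \<le> z1 k"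
    "(a1, \<beta>1, s1) = (\<lambda>j. \<Sum>k\<in>K. z1 k * a k j, \<Sum>k\<in>K. z1 k * \<beta> k, \<Sum>k\<in>K. z1 k * s k)"
    by auto
  then show ?case
    using scale(2) by (intro exI[of _ "\<lambda>k. q * z1 k"]) (simp add: mult.assoc sum_distrib_left)
qed

definition satisfies :: "nat \<Rightarrow> (nat \<Rightarrow> real) \<Rightarrow> (nat \<Rightarrow> real) \<times> real \<times> real \<Rightarrow> bool" where
  "satisfies n x c \<longleftrightarrow> (case c of (a, \<beta>, s) \<Rightarrow>
    (\<Sum>j<n. a j * x j) \<le> \<beta> \<and> (0 < s \<longrightarrow> (\<Sum>j<n. a j * x j) < \<beta>))"

text \<open>The one-variable case of elimination. The midpoint of the largest lower and the smallest
  upper bound works: if these coincide, the pairwise condition leaves no strict bound attaining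
  them.\<close>

lemma ex_between:
  fixes L :: "'a \<Rightarrow> real" and U :: "'b \<Rightarrow> real"
  assumes fin: "finite A" "finite B"
    and le: "\<And>q p. q \<in> A \<Longrightarrow> p \<in> B \<Longrightarrow> L q \<le> U p"
    and less: "\<And>q p. q \<in> A \<Longrightarrow> p \<in> B \<Longrightarrow> sl q \<or> su p \<Longrightarrow> L q < U p"
  shows "\<exists>t. (\<forall>q\<in>A. L q \<le> t \<and> (sl q \<longrightarrow> L q < t)) \<and> (\<forall>p\<in>B. t \<le> U p \<and> (su p \<longrightarrow> t < U p))"
proof (cases "A = {} \<or> B = {}")
  case True
  then show ?thesis
  proof
    assume "A = {}"
    have "\<forall>p\<in>B. Min (U ` B) \<le> U p" using fin by auto
    then show ?thesis using \<open>A = {}\<close> by (intro exI[of _ "Min (U ` B) - 1"]) force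
  next
    assume "B = {}"
    have "\<forall>p\<in>A. L p \<le> Max (L ` A)" using fin by auto
    then show ?thesis using \<open>B = {}\<close> by (intro exI[of _ "Max (L ` A) + 1"]) force
  qed
next
  case False
  have "Max (L ` A) \<in> L ` A" "Min (U ` B) \<in> U ` B"
    using fin False by (simp_all add: Max_in Min_in)
  then obtain q0 p0 where q0: "q0 \<in> A" "L q0 = Max (L ` A)" and p0: "p0 \<in> B" "U p0 = Min (U ` B)"
    unfolding image_iff by metis
  have L: "L q \<le> L q0" if "q \<in> A" for q using q0 fin that by auto
  have U: "U p0 \<le> U p" if "p \<in> B" for p using p0 fin that by auto
  show ?thesis
  proof (intro exI[of _ "(L q0 + U p0) / 2"] conjI ballI impI)
    fix q assume q: "q \<in> A"
    show "L q \<le> (L q0 + U p0) / 2" using L[OF q] le[OF q0(1) p0(1)] by simp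
    show "L q < (L q0 + U p0) / 2" if "sl q"
      using L[OF q] le[OF q0(1) p0(1)] less[OF q p0(1)] that by (cases "L q = L q0") auto
  next
    fix p assume p: "p \<in> B"
    show "(L q0 + U p0) / 2 \<le> U p" using U[OF p] le[OF q0(1) p0(1)] by simp
    show "(L q0 + U p0) / 2 < U p" if "su p"
      using U[OF p] le[OF q0(1) p0(1)] less[OF q0(1) p] that by (cases "U p = U p0") auto
  qed
qed

lemma divide_neg_le_iff: "u < 0 \<Longrightarrow> 0 < v \<Longrightarrow> x / u \<le> y / v \<longleftrightarrow> y * u \<le> x * v" for x y u v :: real
  by (simp add: neg_divide_le_eq pos_divide_le_eq)

lemma divide_neg_less_iff: "u < 0 \<Longrightarrow> 0 < v \<Longrightarrow> x / u < y / v \<longleftrightarrow> y * u < x * v" for x y u v :: real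
  by (simp add: neg_divide_less_eq pos_divide_less_eq)

text \<open>Induction on the number of variables. Eliminating the last one keeps the constraints
  without it and adds a combination for each pair of opposite signs. A solution of the smaller
  system extends by a value between the resulting bounds, and a contradiction derived from it is
  also derived from \<open>C\<close>.\<close>

lemma fourier_motzkin:
  assumes "finite C" "\<And>a \<beta> s. (a, \<beta>, s) \<in> C \<Longrightarrow> 0 \<le> s"
  shows "(\<exists>x. \<forall>c\<in>C. satisfies n x c) \<or>
    (\<exists>a \<beta> s. (a, \<beta>, s) \<in> cone C \<and> (\<forall>j<n. a j = 0) \<and> (\<beta> < 0 \<or> \<beta> \<le> 0 \<and> 0 < s))"
  using assms
proof (induction n arbitrary: C)
  case 0
  show ?case
  proof (cases "\<forall>c\<in>C. satisfies 0 (\<lambda>_. 0) c")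
    case False
    then obtain a \<beta> s where "(a, \<beta>, s) \<in> C" "\<not> satisfies 0 (\<lambda>_. 0) (a, \<beta>, s)"
      by auto
    then show ?thesis
      using cone.base[of "(a, \<beta>, s)" C] by (fastforce simp: satisfies_def)
  qed blast
next
  case (Suc n)
  define Z where "Z = {c \<in> C. fst c n = 0}"
  define Pos where "Pos = {c \<in> C. fst c n > 0}"
  define Neg where "Neg = {c \<in> C. fst c n < 0}"
  \<comment> \<open>The positive factors \<open>- a' n\<close> and \<open>a n\<close> cancel
    coefficient \<open>n\<close>, and the third component is positive as soon as one of the two
    constraints is strict.\<close>
  define comb :: "(nat \<Rightarrow> real) \<times> real \<times> real \<Rightarrow> (nat \<Rightarrow> real) \<times> real \<times> real \<Rightarrow> (nat \<Rightarrow> real) \<times> real \<times> real"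
    where "comb = (\<lambda>(a, \<beta>, s) (a', \<beta>', s').
      (\<lambda>j. - a' n * a j + a n * a' j, - a' n * \<beta> + a n * \<beta>', - a' n * s + a n * s'))"
  define C' where "C' = Z \<union> (\<lambda>(p, q). comb p q) ` (Pos \<times> Neg)"
  have fin: "finite Z" "finite Pos" "finite Neg" "finite C'"
    using Suc.prems(1) by (auto simp: Z_def Pos_def Neg_def C'_def)
  have sub: "C' \<subseteq> cone C"
  proof
    fix c assume "c \<in> C'"
    then consider "c \<in> Z" | p q where "p \<in> Pos" "q \<in> Neg" "c = comb p q"
      by (auto simp: C'_def)
    then show "c \<in> cone C"
    proof cases
      case 1
      then show ?thesis by (simp add: Z_def cone.base)
    next
      case 2
      obtain a \<beta> s a' \<beta>' s' where pq: "p = (a, \<beta>, s)" "q = (a', \<beta>', s')"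
        by (metis prod_cases3)
      have h: "(a, \<beta>, s) \<in> cone C" "(a', \<beta>', s') \<in> cone C" "0 < a n" "0 < - a' n"
        using 2 by (auto simp: pq Pos_def Neg_def cone.base)
      show ?thesis
        unfolding 2(3) pq comb_def prod.case
        by (rule cone.add[OF cone.scale[OF h(1,4)] cone.scale[OF h(2,3)]])
    qed
  qed
  have C'0: "a n = 0" if "(a, \<beta>, s) \<in> C'" for a \<beta> s
    using that by (auto simp: C'_def Z_def comb_def)
  have "0 \<le> s" if "(a, \<beta>, s) \<in> C'" for a \<beta> s
    using cone_nonneg[of a \<beta> s C] that sub Suc.prems(2) by blast
  then consider x where "\<forall>c\<in>C'. satisfies n x c" |
    a \<beta> s where "(a, \<beta>, s) \<in> cone C'" "\<forall>j<n. a j = 0" "\<beta> < 0 \<or> \<beta> \<le> 0 \<and> 0 < s"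
    using Suc.IH[OF fin(4)] by metis
  then show ?case
  proof cases
    case 1
    define ev where "ev c = (\<Sum>j<n. fst c j * x j)" for c :: "(nat \<Rightarrow> real) \<times> real \<times> real"
    \<comment> \<open>The bound that \<open>c\<close> puts on variable \<open>n\<close> once the
      others are fixed to \<open>x\<close>: an upper bound for \<open>Pos\<close>, a lower one for
      \<open>Neg\<close>.\<close>
    define bd where "bd c = (fst (snd c) - ev c) / fst c n" for c :: "(nat \<Rightarrow> real) \<times> real \<times> real"
    define st where "st c \<longleftrightarrow> 0 < snd (snd c)" for c :: "(nat \<Rightarrow> real) \<times> real \<times> real"
    have pair: "bd q \<le> bd p \<and> (st q \<or> st p \<longrightarrow> bd q < bd p)" if "q \<in> Neg" "p \<in> Pos" for p q
    proof -
      obtain a \<beta> s a' \<beta>' s' where pq: "p = (a, \<beta>, s)" "q = (a', \<beta>', s')"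
        by (metis prod_cases3)
      have pos: "0 < a n" "a' n < 0" "0 \<le> s" "0 \<le> s'"
        using that Suc.prems(2) by (auto simp: pq Pos_def Neg_def)
      have "satisfies n x (comb p q)" using 1 that by (force simp: C'_def)
      moreover have "(\<Sum>j<n. (- a' n * a j + a n * a' j) * x j) = - a' n * ev p + a n * ev q"
        by (simp add: ev_def pq algebra_simps sum.distrib sum_subtractf sum_distrib_left sum_negf)
      ultimately have c: "- a' n * ev p + a n * ev q \<le> - a' n * \<beta> + a n * \<beta>'"
        "0 < - a' n * s + a n * s' \<Longrightarrow> - a' n * ev p + a n * ev q < - a' n * \<beta> + a n * \<beta>'"
        by (auto simp: satisfies_def comb_def pq)
      have "0 \<le> - a' n * s" "0 \<le> a n * s'" "st q \<Longrightarrow> 0 < a n * s'" "st p \<Longrightarrow> 0 < - a' n * s"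
        using pos by (simp_all add: st_def pq mult_nonpos_nonneg mult_neg_pos)
      then have "0 < - a' n * s + a n * s'" if "st q \<or> st p"
        using that by (meson add_nonneg_pos add_pos_nonneg)
      moreover have "bd q \<le> bd p \<longleftrightarrow> (\<beta> - ev p) * a' n \<le> (\<beta>' - ev q) * a n"
        "bd q < bd p \<longleftrightarrow> (\<beta> - ev p) * a' n < (\<beta>' - ev q) * a n"
        using divide_neg_le_iff[OF pos(2,1)] divide_neg_less_iff[OF pos(2,1)] by (simp_all add: bd_def pq)
      then have "bd q \<le> bd p \<longleftrightarrow> - a' n * ev p + a n * ev q \<le> - a' n * \<beta> + a n * \<beta>'"
        "bd q < bd p \<longleftrightarrow> - a' n * ev p + a n * ev q < - a' n * \<beta> + a n * \<beta>'"
        by (simp_all add: algebra_simps)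
      ultimately show ?thesis using c by simp
    qed
    obtain t where t: "\<forall>q\<in>Neg. bd q \<le> t \<and> (st q \<longrightarrow> bd q < t)" "\<forall>p\<in>Pos. t \<le> bd p \<and> (st p \<longrightarrow> t < bd p)"
    proof -
      have "\<exists>t. (\<forall>q\<in>Neg. bd q \<le> t \<and> (st q \<longrightarrow> bd q < t)) \<and> (\<forall>p\<in>Pos. t \<le> bd p \<and> (st p \<longrightarrow> t < bd p))"
        by (rule ex_between[OF fin(3,2)]) (use pair in blast)+
      then show ?thesis using that by blast
    qed
    have "satisfies (Suc n) (x(n := t)) c" if cC: "c \<in> C" for c
    proof -
      obtain a \<beta> s where c: "c = (a, \<beta>, s)" by (cases c) auto
      have ev: "(\<Sum>j<Suc n. a j * (x(n := t)) j) = ev c + a n * t"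
        by (simp add: ev_def c)
      consider "c \<in> Z" | "c \<in> Pos" | "c \<in> Neg"
        using cC linorder_less_linear[of "fst c n" 0] unfolding Z_def Pos_def Neg_def by blast
      then have "ev c + a n * t \<le> \<beta> \<and> (0 < s \<longrightarrow> ev c + a n * t < \<beta>)"
      proof cases
        case 1
        then have "satisfies n x c" "a n = 0" using \<open>\<forall>c\<in>C'. satisfies n x c\<close> by (auto simp: C'_def Z_def c)
        then show ?thesis by (simp add: satisfies_def c ev_def)
      next
        case 2
        then have "0 < a n" "t \<le> bd c \<and> (st c \<longrightarrow> t < bd c)"
          using t by (auto simp: Pos_def c)
        then show ?thesis by (simp add: bd_def st_def c pos_le_divide_eq pos_less_divide_eq algebra_simps)
      next
        case 3
        then have "a n < 0" "bd c \<le> t \<and> (st c \<longrightarrow> bd c < t)"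
          using t by (auto simp: Neg_def c)
        then show ?thesis by (simp add: bd_def st_def c neg_divide_le_eq neg_divide_less_eq algebra_simps)
      qed
      then show ?thesis
        unfolding satisfies_def c prod.case ev[unfolded c] by (simp add: c)
    qed
    then show ?thesis by blast
  next
    case 2
    have "a n = 0" using cone_coeff_zero[OF 2(1)] C'0 by blast
    then have "\<forall>j<Suc n. a j = 0" using 2(2) by (simp add: less_Suc_eq)
    then show ?thesis using 2 cone_subset[OF sub] by blast
  qed
qed

section \<open>Weak duality, complementary slackness and strict complementarity\<close>

definition dual_feas :: "nat \<Rightarrow> nat \<Rightarrow> (nat \<Rightarrow> nat \<Rightarrow> real) \<Rightarrow> (nat \<Rightarrow> real) \<Rightarrow> (nat \<Rightarrow> real) \<Rightarrow> bool" where
  "dual_feas m n a w y \<longleftrightarrow> (\<forall>i<m. 0 \<le> y i) \<and> (\<forall>j<n. (\<Sum>i<m. y i * a i j) = w j)"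

definition dual_opt ::
  "nat \<Rightarrow> nat \<Rightarrow> (nat \<Rightarrow> nat \<Rightarrow> real) \<Rightarrow> (nat \<Rightarrow> real) \<Rightarrow> (nat \<Rightarrow> real) \<Rightarrow> (nat \<Rightarrow> real) \<Rightarrow> bool" where
  "dual_opt m n a b w y \<longleftrightarrow> dual_feas m n a w y \<and>
    (\<forall>y'. dual_feas m n a w y' \<longrightarrow> (\<Sum>i<m. y i * b i) \<le> (\<Sum>i<m. y' i * b i))"

lemma duality_gap:
  assumes "dual_feas m n a w y"
  shows "(\<Sum>i<m. y i * b i) - (\<Sum>j<n. w j * x j) = (\<Sum>i<m. y i * (b i - (\<Sum>j<n. a i j * x j)))"
proof -
  have "(\<Sum>j<n. w j * x j) = (\<Sum>j<n. (\<Sum>i<m. y i * a i j) * x j)"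
    using assms by (simp add: dual_feas_def)
  also have "\<dots> = (\<Sum>i<m. y i * (\<Sum>j<n. a i j * x j))"
    unfolding sum_distrib_left sum_distrib_right by (subst sum.swap) (simp add: mult_ac)
  finally show ?thesis by (simp add: right_diff_distrib sum_subtractf)
qed

lemma weak_duality:
  assumes "dual_feas m n a w y" "\<And>i. i < m \<Longrightarrow> (\<Sum>j<n. a i j * x j) \<le> b i"
  shows "(\<Sum>j<n. w j * x j) \<le> (\<Sum>i<m. y i * b i)"
proof -
  have "0 \<le> (\<Sum>i<m. y i * (b i - (\<Sum>j<n. a i j * x j)))"
    using assms by (intro sum_nonneg mult_nonneg_nonneg) (auto simp: dual_feas_def)
  then show ?thesis using duality_gap[OF assms(1), of b x] by simp
qed

lemma complementary_slackness:
  assumes "dual_feas m n a w y" "\<And>i. i < m \<Longrightarrow> (\<Sum>j<n. a i j * x j) \<le> b i"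
    and "(\<Sum>i<m. y i * b i) = (\<Sum>j<n. w j * x j)" "i < m"
  shows "y i = 0 \<or> (\<Sum>j<n. a i j * x j) = b i"
proof -
  have "(\<Sum>i<m. y i * (b i - (\<Sum>j<n. a i j * x j))) = 0"
    using duality_gap[OF assms(1), of b x] assms(3) by simp
  moreover have "\<forall>i\<in>{..<m}. 0 \<le> y i * (b i - (\<Sum>j<n. a i j * x j))"
    using assms by (auto simp: dual_feas_def)
  ultimately have "y i * (b i - (\<Sum>j<n. a i j * x j)) = 0"
    using sum_nonneg_eq_0_iff[of "{..<m}" "\<lambda>i. y i * (b i - (\<Sum>j<n. a i j * x j))"] assms(4) by simp
  then show ?thesis by auto
qed

text \<open>Without such an \<open>x\<close>, the multipliers of a Fourier-Motzkin certificate would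
  yield an optimal dual solution positive at \<open>i0\<close>. For \<open>i0 \<ge> m\<close> no row
  is strict, and the result is plain strong duality.\<close>

lemma ex_primal_slack:
  fixes y :: "nat \<Rightarrow> real"
  assumes opt: "dual_opt m n a b w y"
    and zero: "\<And>y'. dual_opt m n a b w y' \<Longrightarrow> i0 < m \<Longrightarrow> y' i0 = 0"
  shows "\<exists>x. (\<forall>i<m. (\<Sum>j<n. a i j * x j) \<le> b i) \<and> (\<Sum>i<m. y i * b i) \<le> (\<Sum>j<n. w j * x j) \<and>
    (i0 < m \<longrightarrow> (\<Sum>j<n. a i0 j * x j) < b i0)"
proof -
  define \<delta> where "\<delta> = (\<Sum>i<m. y i * b i)"
  \<comment> \<open>Index \<open>m\<close> carries the extra row
    \<open>- w x \<le> - \<delta>\<close>, which demands the optimal value.\<close>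
  define A where "A k j = (if k < m then a k j else - w j)" for k j
  define B where "B k = (if k < m then b k else - \<delta>)" for k
  define S :: "nat \<Rightarrow> real" where "S k = (if k = i0 \<and> k < m then 1 else 0)" for k
  define C where "C = (\<lambda>k. (A k, B k, S k)) ` {..m}"
  have "(\<exists>x. \<forall>c\<in>C. satisfies n x c) \<or>
    (\<exists>\<alpha> \<beta> s. (\<alpha>, \<beta>, s) \<in> cone C \<and> (\<forall>j<n. \<alpha> j = 0) \<and> (\<beta> < 0 \<or> \<beta> \<le> 0 \<and> 0 < s))"
    by (rule fourier_motzkin) (auto simp: C_def S_def)
  then
  consider x where "\<forall>c\<in>C. satisfies n x c" |
    \<alpha> \<beta> s where "(\<alpha>, \<beta>, s) \<in> cone C" "\<forall>j<n. \<alpha> j = 0" "\<beta> < 0 \<or> \<beta> \<le> 0 \<and> 0 < s"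
    by metis
  then show ?thesis
  proof cases
    case 1
    have k: "satisfies n x (A k, B k, S k)" if "k \<le> m" for k
      using 1 that by (simp add: C_def)
    have "(\<Sum>j<n. a i j * x j) \<le> b i" "i = i0 \<Longrightarrow> (\<Sum>j<n. a i j * x j) < b i" if "i < m" for i
      using k[of i] that by (auto simp: satisfies_def A_def B_def S_def)
    moreover have "\<delta> \<le> (\<Sum>j<n. w j * x j)"
      using k[of m] by (simp add: satisfies_def A_def B_def sum_negf)
    ultimately show ?thesis unfolding \<delta>_def by blast
  next
    case 2
    obtain z where z: "\<forall>k\<in>{..m}. 0 \<le> z k"
      "(\<alpha>, \<beta>, s) = (\<lambda>j. \<Sum>k\<in>{..m}. z k * A k j, \<Sum>k\<in>{..m}. z k * B k, \<Sum>k\<in>{..m}. z k * S k)"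
      using cone_image[OF 2(1)[unfolded C_def]] by blast
    have split: "(\<Sum>k\<in>{..m}. h k) = (\<Sum>k<m. h k) + h m" for h :: "nat \<Rightarrow> real"
      by (simp add: lessThan_Suc_atMost[symmetric])
    have \<alpha>: "(\<Sum>k<m. z k * a k j) = z m * w j" if "j < n" for j
      using 2(2) that z(2) by (auto simp: split A_def)
    have \<beta>: "\<beta> = (\<Sum>k<m. z k * b k) - z m * \<delta>"
      using z(2) by (simp add: split B_def)
    have s: "s = (if i0 < m then z i0 else 0)"
    proof -
      have "s = (\<Sum>k<m. z k * S k)"
        using z(2) by (simp add: split S_def)
      also have "\<dots> = (\<Sum>k<m. if k = i0 then z k else 0)"
        by (intro sum.cong) (auto simp: S_def)
      finally have "s = (\<Sum>k<m. if k = i0 then z k else 0)" .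
      then show ?thesis by simp
    qed
    \<comment> \<open>The certificate makes \<open>z\<close> a dual solution for
      \<open>z m * w\<close>. Adding \<open>y\<close> gives total weight \<open>1 + z m\<close>,
      which is positive even if \<open>z m = 0\<close>, so it can be normalized.\<close>
    define y' where "y' i = (y i + z i) / (1 + z m)" for i
    have pos: "0 < 1 + z m" using z(1) by (simp add: add_pos_nonneg)
    have ynn: "\<forall>i<m. 0 \<le> y i" and ya: "\<And>j. j < n \<Longrightarrow> (\<Sum>i<m. y i * a i j) = w j"
      using opt by (auto simp: dual_opt_def dual_feas_def)
    have val: "(\<Sum>i<m. y' i * h i) = ((\<Sum>i<m. y i * h i) + (\<Sum>i<m. z i * h i)) / (1 + z m)" for h
      by (simp add: y'_def sum_divide_distrib[symmetric] distrib_right sum.distrib)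
    have "dual_feas m n a w y'"
      unfolding dual_feas_def
    proof (intro conjI allI impI)
      show "0 \<le> y' i" if "i < m" for i using ynn z(1) that pos by (simp add: y'_def)
      show "(\<Sum>i<m. y' i * a i j) = w j" if "j < n" for j
        using pos by (simp add: val ya \<alpha> that field_simps)
    qed
    have bval: "(\<Sum>i<m. y' i * b i) = \<delta> + \<beta> / (1 + z m)"
      unfolding val[of b] \<beta> \<delta>_def[symmetric] using pos by (simp add: field_simps)
    have "\<delta> \<le> (\<Sum>i<m. y' i * b i)"
      using opt \<open>dual_feas m n a w y'\<close> by (simp add: dual_opt_def \<delta>_def)
    then have "0 \<le> \<beta>" using pos by (simp add: bval zero_le_divide_iff)
    \<comment> \<open>Optimality of \<open>y\<close> excludes \<open>\<beta> < 0\<close>, so the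
      contradiction comes from strictness, that is, from weight on row \<open>i0\<close>.\<close>
    with 2(3) have "\<beta> = 0" "0 < s" by auto
    have "dual_opt m n a b w y'"
      using opt \<open>dual_feas m n a w y'\<close> bval \<open>\<beta> = 0\<close> by (simp add: dual_opt_def \<delta>_def)
    moreover have "i0 < m" "0 < z i0" using \<open>0 < s\<close> s by (auto split: if_splits)
    ultimately have "y' i0 = 0" using zero by blast
    moreover have "0 < y' i0"
      using ynn \<open>i0 < m\<close> \<open>0 < z i0\<close> pos by (simp add: y'_def add_nonneg_pos)
    ultimately show ?thesis by simp
  qed
qed

lemma average_le:
  fixes h :: "'a \<Rightarrow> real"
  assumes "finite K" "K \<noteq> {}" "\<And>k. k \<in> K \<Longrightarrow> h k \<le> c"
  shows "(\<Sum>k\<in>K. h k) / card K \<le> c"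
    and "\<exists>k\<in>K. h k < c \<Longrightarrow> (\<Sum>k\<in>K. h k) / card K < c"
proof -
  have pos: "0 < real (card K)" using assms by (simp add: card_gt_0_iff)
  have "(\<Sum>k\<in>K. h k) \<le> (\<Sum>k\<in>K. c)" using assms by (intro sum_mono) auto
  then show "(\<Sum>k\<in>K. h k) / card K \<le> c" using pos by (simp add: pos_divide_le_eq mult.commute)
  assume "\<exists>k\<in>K. h k < c"
  then have "(\<Sum>k\<in>K. h k) < (\<Sum>k\<in>K. c)" using assms by (intro sum_strict_mono_ex1) auto
  then show "(\<Sum>k\<in>K. h k) / card K < c" using pos by (simp add: pos_divide_less_eq mult.commute)
qed

lemma sum_average:
  fixes X :: "'a \<Rightarrow> nat \<Rightarrow> real"
  shows "(\<Sum>j<n. h j * ((\<Sum>k\<in>K. X k j) / c)) = (\<Sum>k\<in>K. \<Sum>j<n. h j * X k j) / c"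
  by (subst sum.swap) (simp add: sum_divide_distrib sum_distrib_left)

text \<open>The Goldman-Tucker theorem. For each row, some optimal dual solution is nonzero there or
  some optimal primal solution is slack there. Averaging these witnesses keeps optimality and every
  strict inequality.\<close>

lemma ex_strictly_complementary:
  fixes y :: "nat \<Rightarrow> real"
  assumes opt: "dual_opt m n a b w y"
  shows "\<exists>x yy. dual_opt m n a b w yy \<and> (\<forall>i<m. (\<Sum>j<n. a i j * x j) \<le> b i) \<and>
    (\<Sum>j<n. w j * x j) = (\<Sum>i<m. yy i * b i) \<and>
    (\<forall>i<m. 0 < yy i \<or> (\<Sum>j<n. a i j * x j) < b i)"
proof -
  define \<delta> where "\<delta> = (\<Sum>i<m. y i * b i)"
  define T where "T = {i. i < m \<and> (\<exists>y'. dual_opt m n a b w y' \<and> y' i \<noteq> 0)}"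
  have "\<exists>y'. dual_opt m n a b w y' \<and> (k \<in> T \<longrightarrow> y' k \<noteq> 0)" for k
    using opt by (auto simp: T_def)
  then obtain Y where Y: "\<And>k. dual_opt m n a b w (Y k)" "\<And>k. k \<in> T \<Longrightarrow> Y k k \<noteq> 0"
    by metis
  have "\<exists>x. (\<forall>i<m. (\<Sum>j<n. a i j * x j) \<le> b i) \<and> \<delta> \<le> (\<Sum>j<n. w j * x j) \<and>
    (k < m \<longrightarrow> k \<notin> T \<longrightarrow> (\<Sum>j<n. a k j * x j) < b k)" for k
  proof (cases "k \<in> T")
    case True
    \<comment> \<open>Index \<open>m\<close> is no row, so only an optimal primal solution is
      requested.\<close>
    then show ?thesis unfolding \<delta>_def using ex_primal_slack[OF opt, of m] by auto
  next
    case False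
    then have "y' k = 0" if "dual_opt m n a b w y'" "k < m" for y'
      using that by (auto simp: T_def)
    then show ?thesis unfolding \<delta>_def using ex_primal_slack[OF opt, of k] by blast
  qed
  then obtain X where X: "\<And>k i. i < m \<Longrightarrow> (\<Sum>j<n. a i j * X k j) \<le> b i"
    "\<And>k. \<delta> \<le> (\<Sum>j<n. w j * X k j)" "\<And>k. k < m \<Longrightarrow> k \<notin> T \<Longrightarrow> (\<Sum>j<n. a k j * X k j) < b k"
    by metis
  \<comment> \<open>The extra index \<open>m\<close> keeps \<open>K\<close> nonempty when there are
    no rows.\<close>
  define K where "K = {..m}"
  have K: "finite K" "K \<noteq> {}" by (auto simp: K_def)
  define x where "x j = (\<Sum>k\<in>K. X k j) / card K" for j
  define yy where "yy i = (\<Sum>k\<in>K. Y k i) / card K" for i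
  have cK: "0 < real (card K)" using K by (simp add: card_gt_0_iff)
  have Yf: "dual_feas m n a w (Y k)" for k using Y(1) by (simp add: dual_opt_def)
  have Yv: "(\<Sum>i<m. Y k i * b i) = \<delta>" for k
    using Y(1)[of k] opt Yf[of k] unfolding dual_opt_def \<delta>_def by (metis antisym)
  have yyv: "(\<Sum>i<m. yy i * h i) = (\<Sum>k\<in>K. \<Sum>i<m. Y k i * h i) / card K" for h
    using sum_average[where h = h and X = Y] by (simp add: yy_def mult.commute)
  have feas: "dual_feas m n a w yy"
    unfolding dual_feas_def
  proof (intro conjI allI impI)
    show "0 \<le> yy i" if "i < m" for i
      using Yf that by (auto simp: yy_def dual_feas_def intro!: divide_nonneg_nonneg sum_nonneg)
    show "(\<Sum>i<m. yy i * a i j) = w j" if "j < n" for j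
      using Yf that cK by (simp add: yyv dual_feas_def)
  qed
  have yyb: "(\<Sum>i<m. yy i * b i) = \<delta>"
    using cK by (simp add: yyv Yv)
  have 1: "dual_opt m n a b w yy"
    using opt feas by (simp add: dual_opt_def yyb) (simp add: \<delta>_def)
  have 2: "(\<Sum>j<n. a i j * x j) \<le> b i" if "i < m" for i
    unfolding x_def sum_average using X(1)[OF that] K by (intro average_le) auto
  have "(\<Sum>j<n. - w j * x j) \<le> - \<delta>"
    unfolding x_def sum_average using X(2) K by (intro average_le) (auto simp: sum_negf)
  then have "\<delta> \<le> (\<Sum>j<n. w j * x j)" by (simp add: sum_negf)
  moreover have "(\<Sum>j<n. w j * x j) \<le> \<delta>"
    using weak_duality[OF feas 2] by (simp add: yyb)
  ultimately have 3: "(\<Sum>j<n. w j * x j) = (\<Sum>i<m. yy i * b i)" by (simp add: yyb)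
  have 4: "0 < yy i \<or> (\<Sum>j<n. a i j * x j) < b i" if i: "i < m" for i
  proof (cases "i \<in> T")
    case True
    have "0 \<le> Y k i" for k using Yf i by (auto simp: dual_feas_def)
    moreover have "0 < Y i i" using Y(2)[OF True] \<open>0 \<le> Y i i\<close> by simp
    moreover have "i \<in> K" using i by (simp add: K_def)
    ultimately have "0 < (\<Sum>k\<in>K. Y k i)" using K by (intro sum_pos2[of K i]) auto
    then show ?thesis using cK by (simp add: yy_def)
  next
    case False
    have "\<exists>k\<in>K. (\<Sum>j<n. a i j * X k j) < b i"
      using X(3)[OF i False] i by (intro bexI[of _ i]) (auto simp: K_def)
    then have "(\<Sum>j<n. a i j * x j) < b i"
      unfolding x_def sum_average using X(1)[OF i] K by (intro average_le(2)) auto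
    then show ?thesis ..
  qed
  from 1 2 3 4 show ?thesis by (intro exI[of _ x] exI[of _ yy]) simp
qed

section \<open>Row subsystems\<close>

lemma pick_lessThan: "j < n \<Longrightarrow> pick {..<n} j = j"
  using pick_reduce_set[of j n UNIV] by (simp add: pick_UNIV lessThan_def)

lemma submatrix_rows:
  assumes "T \<subseteq> {..<dim_row A}"
  shows "dim_row (submatrix A T {..<dim_col A}) = card T"
    and "dim_col (submatrix A T {..<dim_col A}) = dim_col A"
    and "i < card T \<Longrightarrow> j < dim_col A \<Longrightarrow> submatrix A T {..<dim_col A} $$ (i, j) = A $$ (pick T i, j)"
proof -
  have "{i. i < dim_row A \<and> i \<in> T} = T" "{j. j < dim_col A \<and> j \<in> {..<dim_col A}} = {..<dim_col A}"
    using assms by auto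
  then show "dim_row (submatrix A T {..<dim_col A}) = card T" "dim_col (submatrix A T {..<dim_col A}) = dim_col A"
    "i < card T \<Longrightarrow> j < dim_col A \<Longrightarrow> submatrix A T {..<dim_col A} $$ (i, j) = A $$ (pick T i, j)"
    by (simp_all add: submatrix_def pick_lessThan)
qed

text \<open>Density of the \<open>p\<close>-adic rationals: truncation in base \<open>p\<close> errs
  by at most \<open>(1 / p) ^ N\<close>.\<close>

lemma floor_padic_tendsto:
  fixes x :: real
  assumes "1 < p"
  shows "(\<lambda>N. real_of_int \<lfloor>real p ^ N * x\<rfloor> / real p ^ N) \<longlonglongrightarrow> x"
proof (rule tendsto_sandwich)
  show "\<forall>\<^sub>F N in sequentially. x - (1 / real p) ^ N \<le> real_of_int \<lfloor>real p ^ N * x\<rfloor> / real p ^ N"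
  proof (rule always_eventually, rule allI)
    fix N
    have "x - (1 / real p) ^ N = (real p ^ N * x - 1) / real p ^ N"
      using assms by (simp add: power_one_over field_simps)
    moreover have "real p ^ N * x - 1 \<le> real_of_int \<lfloor>real p ^ N * x\<rfloor>" by linarith
    ultimately show "x - (1 / real p) ^ N \<le> real_of_int \<lfloor>real p ^ N * x\<rfloor> / real p ^ N"
      by (simp add: divide_right_mono)
  qed
  show "\<forall>\<^sub>F N in sequentially. real_of_int \<lfloor>real p ^ N * x\<rfloor> / real p ^ N \<le> x"
    using assms by (intro always_eventually allI) (simp add: field_simps)
  have "(\<lambda>N. x - (1 / real p) ^ N) \<longlonglongrightarrow> x - 0"
    using assms by (intro tendsto_intros LIMSEQ_realpow_zero) auto
  then show "(\<lambda>N. x - (1 / real p) ^ N) \<longlonglongrightarrow> x" by simp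
qed simp

section \<open>Lattice and kernel results as sums over a set of rows\<close>

context
  fixes A :: "int mat" and T :: "nat set" and M :: "int mat"
  assumes T: "T \<subseteq> {..<dim_row A}"
  defines "M \<equiv> submatrix A T {..<dim_col A}"
begin

lemma finite_rows: "finite T"
  using T finite_subset by blast

lemma sum_submatrix_rows:
  fixes z :: "nat \<Rightarrow> 'a :: comm_ring_1"
  assumes "j < dim_col A"
  shows "(\<Sum>i<dim_row M. z (pick T i) * of_int (M $$ (i, j))) = (\<Sum>i\<in>T. z i * of_int (A $$ (i, j)))"
proof -
  have "(\<Sum>i<dim_row M. z (pick T i) * of_int (M $$ (i, j)))
      = (\<Sum>i<card T. z (pick T i) * of_int (A $$ (pick T i, j)))"
    using assms submatrix_rows[OF T] by (simp add: M_def)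
  also have "\<dots> = (\<Sum>i\<in>T. z i * of_int (A $$ (i, j)))"
    by (rule sum.reindex_bij_betw[OF bij_betw_pick[OF finite_rows]])
  finally show ?thesis .
qed

lemma ex_row_function:
  obtains z' where "\<And>i. i < dim_row M \<Longrightarrow> z' (pick T i) = z i"
proof
  fix i assume "i < dim_row M"
  then show "(z \<circ> inv_into {..<card T} (pick T)) (pick T i) = z i"
    using bij_betw_pick[OF finite_rows] submatrix_rows(1)[OF T]
    by (simp add: M_def bij_betw_def)
qed

lemma ex_int_solution_rows:
  fixes y :: "nat \<Rightarrow> real" and w :: "nat \<Rightarrow> int"
  assumes "Gcd (subdets M (int_rank M)) = 1"
    and y: "\<And>j. j < dim_col A \<Longrightarrow> (\<Sum>i\<in>T. y i * real_of_int (A $$ (i, j))) = real_of_int (w j)"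
  shows "\<exists>z :: nat \<Rightarrow> int. \<forall>j<dim_col A. (\<Sum>i\<in>T. z i * A $$ (i, j)) = w j"
proof -
  have n: "dim_col M = dim_col A" using submatrix_rows[OF T] by (simp add: M_def)
  obtain z where z: "\<And>j. j < dim_col A \<Longrightarrow> (\<Sum>i<dim_row M. z i * M $$ (i, j)) = w j"
    using ex_int_solution[OF assms(1), of "\<lambda>i. y (pick T i)" w] sum_submatrix_rows[where z = y] y
    unfolding n by auto
  obtain z' where z': "\<And>i. i < dim_row M \<Longrightarrow> z' (pick T i) = z i"
    using ex_row_function by blast
  have "(\<Sum>i\<in>T. z' i * A $$ (i, j)) = w j" if "j < dim_col A" for j
    using sum_submatrix_rows[OF that, of z'] z[OF that] z' by simp
  then show ?thesis by blast
qed

lemma ex_nonsaturated_vector_rows: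
  assumes "prime l" "l dvd Gcd (subdets M (int_rank M))"
  shows "\<exists>w y :: nat \<Rightarrow> int. (\<forall>j<dim_col A. (\<Sum>i\<in>T. y i * A $$ (i, j)) = l * w j) \<and>
    (\<forall>z :: nat \<Rightarrow> int. \<exists>j<dim_col A. (\<Sum>i\<in>T. z i * A $$ (i, j)) \<noteq> w j)"
proof -
  have n: "dim_col M = dim_col A" using submatrix_rows[OF T] by (simp add: M_def)
  obtain w y :: "nat \<Rightarrow> int" where wy:
    "\<And>j. j < dim_col A \<Longrightarrow> (\<Sum>i<dim_row M. y i * M $$ (i, j)) = l * w j"
    "\<And>z :: nat \<Rightarrow> int. \<exists>j<dim_col A. (\<Sum>i<dim_row M. z i * M $$ (i, j)) \<noteq> w j"
    using ex_nonsaturated_vector[OF assms] unfolding n by blast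
  obtain y' where y': "\<And>i. i < dim_row M \<Longrightarrow> y' (pick T i) = y i"
    using ex_row_function by blast
  have "(\<Sum>i\<in>T. y' i * A $$ (i, j)) = l * w j" if "j < dim_col A" for j
    using sum_submatrix_rows[OF that, of y'] wy(1)[OF that] y' by simp
  moreover have "\<exists>j<dim_col A. (\<Sum>i\<in>T. z i * A $$ (i, j)) \<noteq> w j" for z
  proof -
    obtain j where "j < dim_col A" "(\<Sum>i<dim_row M. z (pick T i) * M $$ (i, j)) \<noteq> w j"
      using wy(2)[of "\<lambda>i. z (pick T i)"] by blast
    then show ?thesis using sum_submatrix_rows[of j z] by auto
  qed
  ultimately show ?thesis by blast
qed

text \<open>Round \<open>v / d\<close> to \<open>p\<close>-adic entries, then apply the integral
  matrix \<open>P\<close>. The image lies exactly in the kernel, stays \<open>p\<close>-adic and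
  tends to \<open>v\<close>, so the strict bounds hold for large \<open>N\<close>.\<close>

lemma ex_padic_kernel_vector:
  fixes v lb :: "nat \<Rightarrow> real"
  assumes "1 < p" and v: "\<And>j. j < dim_col A \<Longrightarrow> (\<Sum>i\<in>T. v i * real_of_int (A $$ (i, j))) = 0"
    and lb: "\<And>i. i \<in> T \<Longrightarrow> lb i < v i"
  shows "\<exists>u. (\<forall>j<dim_col A. (\<Sum>i\<in>T. u i * real_of_int (A $$ (i, j))) = 0) \<and>
    (\<forall>i\<in>T. lb i < u i \<and> padic p (u i))"
proof -
  let ?m = "dim_row M"
  have n: "dim_col M = dim_col A" and m: "?m = card T" using submatrix_rows[OF T] by (auto simp: M_def)
  define v' where "v' i = v (pick T i)" for i
  have v': "\<And>j. j < dim_col M \<Longrightarrow> (\<Sum>i<?m. v' i * real_of_int (M $$ (i, j))) = 0"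
    unfolding v'_def n using sum_submatrix_rows[where z = v] v by simp
  obtain d :: int and P where d: "d \<noteq> 0"
    and P: "\<forall>v :: nat \<Rightarrow> real. \<forall>j<dim_col M.
      (\<Sum>i<?m. (\<Sum>k<?m. v k * real_of_int (P k i)) * real_of_int (M $$ (i, j))) = 0"
    and Pv: "\<forall>v :: nat \<Rightarrow> real. (\<forall>j<dim_col M. (\<Sum>i<?m. v i * real_of_int (M $$ (i, j))) = 0) \<longrightarrow>
      (\<forall>i<?m. (\<Sum>k<?m. v k * real_of_int (P k i)) = real_of_int d * v i)"
    using ex_projection_onto_left_kernel[of M] by (elim exE conjE)
  \<comment> \<open>Division by \<open>d\<close> precedes the rounding: \<open>d\<close> need not be
    a power of \<open>p\<close>, so dividing afterwards could leave the \<open>p\<close>-adic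
    rationals.\<close>
  define c where "c N k = real_of_int \<lfloor>real p ^ N * (v' k / d)\<rfloor> / real p ^ N" for N k
  define u' where "u' N i = (\<Sum>k<?m. c N k * real_of_int (P k i))" for N i
  have "(\<lambda>N. u' N i) \<longlonglongrightarrow> v' i" if "i < ?m" for i
  proof -
    have "(\<lambda>N. u' N i) \<longlonglongrightarrow> (\<Sum>k<?m. v' k / d * real_of_int (P k i))"
      unfolding u'_def c_def by (intro tendsto_intros floor_padic_tendsto assms(1))
    also have "(\<Sum>k<?m. v' k / d * real_of_int (P k i)) = (\<Sum>k<?m. v' k * real_of_int (P k i)) / d"
      by (simp add: sum_divide_distrib)
    also have "\<dots> = v' i" using Pv v' that d by simp
    finally show ?thesis .
  qed
  moreover have "lb (pick T i) < v' i" if "i < ?m" for i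
    using lb[of "pick T i"] that m by (simp add: v'_def pick_in_set_le)
  ultimately have "\<forall>\<^sub>F N in sequentially. lb (pick T i) < u' N i" if "i < ?m" for i
    using that by (intro order_tendstoD(1)[of _ "v' i"])
  then have "\<forall>\<^sub>F N in sequentially. \<forall>i\<in>{..<?m}. lb (pick T i) < u' N i"
    by (intro eventually_ball_finite) auto
  then obtain N where N: "\<And>i. i < ?m \<Longrightarrow> lb (pick T i) < u' N i"
    by (auto simp: eventually_sequentially)
  obtain u where u: "\<And>i. i < ?m \<Longrightarrow> u (pick T i) = u' N i"
    using ex_row_function by blast
  have pick: "\<exists>k<?m. i = pick T k" if "i \<in> T" for i
    using bij_betw_pick[OF finite_rows] that m by (auto simp: bij_betw_def)
  show ?thesis
  proof (intro exI[of _ u] conjI allI ballI impI)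
    show "(\<Sum>i\<in>T. u i * real_of_int (A $$ (i, j))) = 0" if "j < dim_col A" for j
      using sum_submatrix_rows[OF that, of u] P[rule_format, of j "c N"] u that n by (simp add: u'_def)
    show "lb i < u i" if "i \<in> T" for i
      using pick[OF that] N u by auto
    have "padic p (u' N i)" for i
      unfolding padic_def u'_def c_def
      by (rule exI[of _ "\<Sum>k<?m. \<lfloor>real p ^ N * (v' k / d)\<rfloor> * P k i"], rule exI[of _ N])
        (simp add: sum_divide_distrib)
    then show "padic p (u i)" if "i \<in> T" for i
      using pick[OF that] u by auto
  qed
qed

end

lemma ex_common_padic_exponent:
  assumes "finite T" "\<And>i. i \<in> T \<Longrightarrow> padic p (y i)" "0 < p"
  shows "\<exists>K (u :: nat \<Rightarrow> int). \<forall>i\<in>T. real p ^ K * y i = u i"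
  using assms(1,2)
proof (induction rule: finite_induct)
  case (insert t T)
  obtain K u where u: "\<forall>i\<in>T. real p ^ K * y i = real_of_int (u i)"
    using insert by blast
  obtain a k where "y t = real_of_int a / real p ^ k"
    using insert.prems[of t] by (auto simp: padic_def)
  then have t: "real p ^ k * y t = real_of_int a" using assms(3) by simp
  show ?case
  proof (intro exI ballI)
    fix i assume i: "i \<in> insert t T"
    show "real p ^ (K + k) * y i = real_of_int (if i = t then int p ^ K * a else int p ^ k * u i)"
    proof (cases "i = t")
      case True
      then show ?thesis using t by (simp add: power_add mult.assoc)
    next
      case False
      then have "real p ^ K * y i = real_of_int (u i)" using i u by simp
      then show ?thesis using False by (simp add: power_add mult_ac)
    qed
  qed
qed simp

section \<open>Total dual p-adicness\<close>

abbreviation real_entry :: "int mat \<Rightarrow> nat \<Rightarrow> nat \<Rightarrow> real" where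
  "real_entry A i j \<equiv> real_of_int (A $$ (i, j))"

abbreviation real_coord :: "int vec \<Rightarrow> nat \<Rightarrow> real" where
  "real_coord v i \<equiv> real_of_int (v $ i)"

lemma row_scalar_prod:
  assumes "i < dim_row A" "x \<in> carrier_vec (dim_col A)"
  shows "row (map_mat real_of_int A) i \<bullet> x = (\<Sum>j<dim_col A. real_entry A i j * x $ j)"
  using assms by (simp add: scalar_prod_def lessThan_atLeast0)

lemma map_vec_scalar_prod:
  assumes "v \<in> carrier_vec n" "x \<in> carrier_vec n"
  shows "map_vec real_of_int v \<bullet> x = (\<Sum>j<n. real_coord v j * x $ j)"
  using assms by (simp add: scalar_prod_def lessThan_atLeast0)

lemma mem_polyhedron_iff:
  "x \<in> polyhedron A b \<longleftrightarrow> x \<in> carrier_vec (dim_col A) \<and>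
    (\<forall>i<dim_row A. (\<Sum>j<dim_col A. real_entry A i j * x $ j) \<le> real_coord b i)"
  by (auto simp: polyhedron_def row_scalar_prod)

lemma dual_feasible_iff:
  assumes "w \<in> carrier_vec (dim_col A)"
  shows "dual_feasible A w y \<longleftrightarrow> y \<in> carrier_vec (dim_row A) \<and>
    dual_feas (dim_row A) (dim_col A) (real_entry A) (real_coord w) (($) y)"
proof -
  have "transpose_mat (map_mat real_of_int A) *\<^sub>v y = map_vec real_of_int w \<longleftrightarrow>
      (\<forall>j<dim_col A. (\<Sum>i<dim_row A. y $ i * real_entry A i j) = real_coord w j)"
    if "y \<in> carrier_vec (dim_row A)"
    using assms that
    by (auto simp: vec_eq_iff scalar_prod_def lessThan_atLeast0 mult.commute)
  then show ?thesis
    by (auto simp: dual_feasible_def dual_feas_def)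
qed

lemma dual_optimal_iff:
  assumes "w \<in> carrier_vec (dim_col A)" "b \<in> carrier_vec (dim_row A)"
  shows "dual_optimal A b w y \<longleftrightarrow> y \<in> carrier_vec (dim_row A) \<and>
    dual_opt (dim_row A) (dim_col A) (real_entry A) (real_coord b) (real_coord w) (($) y)"
proof -
  let ?feas = "dual_feas (dim_row A) (dim_col A) (real_entry A) (real_coord w)"
  have val: "map_vec real_of_int b \<bullet> y = (\<Sum>i<dim_row A. y $ i * real_coord b i)"
    if "y \<in> carrier_vec (dim_row A)" for y
    using map_vec_scalar_prod[OF assms(2) that] by (simp add: mult.commute)
  have vec: "vec (dim_row A) y' \<in> carrier_vec (dim_row A)"
    "?feas (($) (vec (dim_row A) y')) \<longleftrightarrow> ?feas y'"
    "(\<Sum>i<dim_row A. vec (dim_row A) y' $ i * h i) = (\<Sum>i<dim_row A. y' i * h i)" for y' and h :: "nat \<Rightarrow> real"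
    by (auto simp: dual_feas_def)
  have "(\<forall>y'. y' \<in> carrier_vec (dim_row A) \<and> ?feas (($) y') \<longrightarrow> c \<le> (\<Sum>i<dim_row A. y' $ i * real_coord b i))
    \<longleftrightarrow> (\<forall>y'. ?feas y' \<longrightarrow> c \<le> (\<Sum>i<dim_row A. y' i * real_coord b i))" (is "?L \<longleftrightarrow> ?R") for c
  proof
    assume ?L
    show ?R
    proof (intro allI impI)
      fix y' assume "?feas y'"
      then show "c \<le> (\<Sum>i<dim_row A. y' i * real_coord b i)"
        using \<open>?L\<close>[rule_format, of "vec (dim_row A) y'"] vec by simp
    qed
  qed blast
  then show ?thesis
    unfolding dual_optimal_def dual_opt_def dual_feasible_iff[OF assms(1)]
    by (auto simp: val)
qed

text \<open>Every nonnegative dual solution supported on the tight rows of the face of maximizers is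
  optimal. So it suffices to replace the strictly complementary \<open>y\<close> by a
  \<open>p\<close>-adic solution that is still positive on those rows.\<close>

lemma totally_dual_padic_if_Gcd_subdets_eq_1:
  assumes b: "dim_vec b = dim_row A" and p: "prime (p :: nat)"
    and gcd: "\<And>F. is_face A b F \<Longrightarrow> F \<noteq> {} \<Longrightarrow>
      Gcd (subdets (face_matrix A b F) (int_rank (face_matrix A b F))) = 1"
  shows "totally_dual_padic A b p"
  unfolding totally_dual_padic_def
proof (intro ballI impI)
  let ?m = "dim_row A" and ?n = "dim_col A"
  let ?a = "real_entry A" and ?b = "real_coord b"
  fix w assume w: "w \<in> carrier_vec ?n" and "\<exists>y. dual_optimal A b w y"
  let ?w = "real_coord w"
  have bc: "b \<in> carrier_vec ?m" using b by (rule carrier_vecI)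
  obtain y0 where opt0: "dual_opt ?m ?n ?a ?b ?w (($) y0)"
    using \<open>\<exists>y. dual_optimal A b w y\<close> dual_optimal_iff[OF w bc] by blast
  obtain x y where opt: "dual_opt ?m ?n ?a ?b ?w y"
    and xall: "\<forall>i<?m. (\<Sum>j<?n. ?a i j * x j) \<le> ?b i"
    and wx: "(\<Sum>j<?n. ?w j * x j) = (\<Sum>i<?m. y i * ?b i)"
    and strictall: "\<forall>i<?m. 0 < y i \<or> (\<Sum>j<?n. ?a i j * x j) < ?b i"
    using ex_strictly_complementary[OF opt0] by blast
  note x = xall[rule_format] and strict = strictall[rule_format]
  have feas: "dual_feas ?m ?n ?a ?w y" using opt by (simp add: dual_opt_def)
  define \<delta> where "\<delta> = (\<Sum>i<?m. y i * ?b i)"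
  define F where "F = {x \<in> polyhedron A b. map_vec real_of_int w \<bullet> x = \<delta>}"
  have wdot: "map_vec real_of_int w \<bullet> x' = (\<Sum>j<?n. ?w j * x' $ j)" if "x' \<in> polyhedron A b" for x'
    using that w by (intro map_vec_scalar_prod) (auto simp: polyhedron_def)
  have "is_face A b F"
    unfolding is_face_def
  proof (intro exI conjI ballI)
    show "map_vec real_of_int w \<in> carrier_vec ?n" using w by simp
    show "map_vec real_of_int w \<bullet> x' \<le> \<delta>" if "x' \<in> polyhedron A b" for x'
      unfolding wdot[OF that] \<delta>_def using that
      by (intro weak_duality[OF feas]) (simp add: mem_polyhedron_iff)
  qed (rule F_def)
  have xF: "vec ?n x \<in> F"
    using x wx by (auto simp: F_def mem_polyhedron_iff wdot \<delta>_def)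
  define T where "T = tight_rows A b F"
  have T: "T \<subseteq> {..<?m}" by (auto simp: T_def tight_rows_def)
  have tight: "(\<Sum>j<?n. ?a i j * x' $ j) = ?b i" if "i \<in> T" "x' \<in> F" for i x'
    using that by (auto simp: T_def tight_rows_def F_def mem_polyhedron_iff row_scalar_prod)
  \<comment> \<open>Strict complementarity at \<open>x\<close> gives one direction, complementary
    slackness at every point of \<open>F\<close> the other.\<close>
  have mem_T: "i \<in> T \<longleftrightarrow> 0 < y i" if i: "i < ?m" for i
  proof
    assume "i \<in> T"
    then have "(\<Sum>j<?n. ?a i j * x j) = ?b i" using tight[OF _ xF] by simp
    then show "0 < y i" using strict[OF i] by simp
  next
    assume yi: "0 < y i"
    have "(\<Sum>j<?n. ?a i j * x' $ j) = ?b i" if "x' \<in> F" for x'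
    proof -
      have "(\<Sum>i<?m. y i * ?b i) = (\<Sum>j<?n. ?w j * x' $ j)"
        using that wdot[of x'] by (simp add: F_def \<delta>_def)
      then show ?thesis
        using complementary_slackness[OF feas, of "($) x'" ?b i] that yi i
        by (auto simp: F_def mem_polyhedron_iff)
    qed
    then show "i \<in> T"
      using i by (auto simp: T_def tight_rows_def F_def mem_polyhedron_iff row_scalar_prod)
  qed
  have y0: "y i = 0" if "i < ?m" "i \<notin> T" for i
    using mem_T[OF that(1)] that feas by (force simp: dual_feas_def)
  have sumT: "(\<Sum>i<?m. h i) = (\<Sum>i\<in>T. h i)" if "\<And>i. i < ?m \<Longrightarrow> i \<notin> T \<Longrightarrow> h i = 0" for h :: "nat \<Rightarrow> real"
    using T that by (intro sum.mono_neutral_right) auto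
  have yT: "(\<Sum>i\<in>T. y i * ?a i j) = ?w j" if "j < ?n" for j
    using feas that sumT[of "\<lambda>i. y i * ?a i j"] y0 by (simp add: dual_feas_def)
  have "Gcd (subdets (submatrix A T {..<?n}) (int_rank (submatrix A T {..<?n}))) = 1"
    using gcd[OF \<open>is_face A b F\<close>] xF by (auto simp: face_matrix_def T_def)
  then obtain z :: "nat \<Rightarrow> int" where z: "\<And>j. j < ?n \<Longrightarrow> (\<Sum>i\<in>T. z i * A $$ (i, j)) = w $ j"
    using ex_int_solution_rows[OF T, of y "($) w"] yT by blast
  have zr: "(\<Sum>i\<in>T. real_of_int (z i) * ?a i j) = ?w j" if "j < ?n" for j
    using arg_cong[OF z[OF that], of real_of_int] by simp
  \<comment> \<open>Relative to the integral solution \<open>z\<close>, positivity of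
    \<open>y\<close> becomes an open condition on a kernel vector, which a \<open>p\<close>-adic one
    can meet.\<close>
  have "(\<Sum>i\<in>T. (y i - z i) * ?a i j) = 0" if "j < ?n" for j
    using yT[OF that] zr[OF that] by (simp add: left_diff_distrib sum_subtractf)
  moreover have "- real_of_int (z i) < y i - z i" if "i \<in> T" for i
    using mem_T[of i] that T by auto
  ultimately have "\<exists>u. (\<forall>j<?n. (\<Sum>i\<in>T. u i * ?a i j) = 0) \<and>
      (\<forall>i\<in>T. - real_of_int (z i) < u i \<and> padic p (u i))"
    by (rule ex_padic_kernel_vector[OF T prime_gt_1_nat[OF p]])
  then obtain u where u: "\<And>j. j < ?n \<Longrightarrow> (\<Sum>i\<in>T. u i * ?a i j) = 0"
    "\<And>i. i \<in> T \<Longrightarrow> - real_of_int (z i) < u i" "\<And>i. i \<in> T \<Longrightarrow> padic p (u i)"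
    by blast
  define y' where "y' i = (if i \<in> T then z i + u i else 0)" for i
  have feas': "dual_feas ?m ?n ?a ?w y'"
    unfolding dual_feas_def
  proof (intro conjI allI impI)
    show "0 \<le> y' i" for i using u(2)[of i] by (cases "i \<in> T") (simp_all add: y'_def)
    fix j assume j: "j < ?n"
    have "(\<Sum>i<?m. y' i * ?a i j) = (\<Sum>i\<in>T. y' i * ?a i j)"
      by (rule sumT) (simp add: y'_def)
    also have "\<dots> = ?w j"
      using zr[OF j] u(1)[OF j] by (simp add: y'_def distrib_right sum.distrib)
    finally show "(\<Sum>i<?m. y' i * ?a i j) = ?w j" .
  qed
  \<comment> \<open>\<open>y'\<close> has weight only on rows tight at \<open>x\<close>, so the
    duality gap vanishes.\<close>
  have "(\<Sum>i<?m. y' i * (?b i - (\<Sum>j<?n. ?a i j * x j))) = 0"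
    using tight[OF _ xF] by (intro sum.neutral) (simp add: y'_def)
  then have "(\<Sum>i<?m. y' i * ?b i) = \<delta>"
    using duality_gap[OF feas', of ?b x] wx by (simp add: \<delta>_def)
  then have "dual_opt ?m ?n ?a ?b ?w y'"
    using opt feas' by (simp add: dual_opt_def \<delta>_def)
  moreover have "padic p (y' i)" for i
  proof (cases "i \<in> T")
    case True
    obtain c k where "u i = real_of_int c / real p ^ k"
      using u(3)[OF True] unfolding padic_def by blast
    then have "y' i = real_of_int (z i * int p ^ k + c) / real p ^ k"
      using True prime_gt_0_nat[OF p] by (simp add: y'_def add_divide_distrib)
    then show ?thesis unfolding padic_def by blast
  next
    case False
    then have "y' i = real_of_int 0 / real p ^ 0" by (simp add: y'_def)
    then show ?thesis unfolding padic_def by blast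
  qed
  moreover have "dual_opt ?m ?n ?a ?b ?w (($) (vec ?m y')) \<longleftrightarrow> dual_opt ?m ?n ?a ?b ?w y'"
    by (simp add: dual_opt_def dual_feas_def)
  ultimately show "\<exists>y. dual_optimal A b w y \<and> (\<forall>i<?m. padic p (y $ i))"
    unfolding dual_optimal_iff[OF w bc] by (intro exI[of _ "vec ?m y'"]) simp
qed

text \<open>Multipliers with denominator \<open>p ^ k\<close> say nothing about divisibility by
  \<open>p\<close>, so a single \<open>p\<close> excludes only the prime divisors
  \<open>l \<noteq> p\<close>; a second prime will deal with \<open>l = p\<close>.\<close>

lemma prime_not_dvd_Gcd_subdets:
  assumes b: "dim_vec b = dim_row A" and p: "prime (p :: nat)" and l: "prime (l :: int)" "l \<noteq> int p"
    and tdp: "totally_dual_padic A b p" and F: "is_face A b F" "F \<noteq> {}"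
  shows "\<not> l dvd Gcd (subdets (face_matrix A b F) (int_rank (face_matrix A b F)))"
proof
  let ?m = "dim_row A" and ?n = "dim_col A"
  let ?a = "real_entry A" and ?b = "real_coord b"
  define T where "T = tight_rows A b F"
  have T: "T \<subseteq> {..<?m}" by (auto simp: T_def tight_rows_def)
  then have "finite T" using finite_subset by blast
  have bc: "b \<in> carrier_vec ?m" using b by (rule carrier_vecI)
  have FP: "x \<in> polyhedron A b" if "x \<in> F" for x using F(1) that by (auto simp: is_face_def)
  have T_iff: "i \<in> T \<longleftrightarrow> (\<forall>x\<in>F. (\<Sum>j<?n. ?a i j * x $ j) = ?b i)" if "i < ?m" for i
    using that FP by (auto simp: T_def tight_rows_def mem_polyhedron_iff row_scalar_prod)
  assume "l dvd Gcd (subdets (face_matrix A b F) (int_rank (face_matrix A b F)))"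
  then have "l dvd Gcd (subdets (submatrix A T {..<?n}) (int_rank (submatrix A T {..<?n})))"
    by (simp add: face_matrix_def T_def)
  then obtain w0 y0 :: "nat \<Rightarrow> int" where
    y0: "\<And>j. j < ?n \<Longrightarrow> (\<Sum>i\<in>T. y0 i * A $$ (i, j)) = l * w0 j" and
    w0: "\<And>z :: nat \<Rightarrow> int. \<exists>j<?n. (\<Sum>i\<in>T. z i * A $$ (i, j)) \<noteq> w0 j"
    using ex_nonsaturated_vector_rows[OF T l(1)] by blast
  \<comment> \<open>Shifting the multipliers by a multiple of \<open>l\<close> makes them nonnegative, so \<open>w\<close> lies in the cone of the tight rows.\<close>
  define K where "K = (\<Sum>i\<in>T. \<bar>y0 i\<bar>)"
  define y1 where "y1 i = y0 i + l * K" for i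
  define w where "w = vec ?n (\<lambda>j. w0 j + K * (\<Sum>i\<in>T. A $$ (i, j)))"
  have w: "w \<in> carrier_vec ?n" by (simp add: w_def)
  let ?w = "real_coord w"
  have l0: "0 < l" using l(1) by (rule prime_gt_0_int)
  have y1: "(\<Sum>i\<in>T. y1 i * A $$ (i, j)) = l * w $ j" if "j < ?n" for j
    using y0[OF that] that
    by (simp add: y1_def w_def distrib_right distrib_left sum.distrib sum_distrib_left mult.assoc)
  \<comment> \<open>\<open>w - w0\<close> is an integral combination of the tight rows, so
    \<open>w\<close> stays outside the lattice.\<close>
  have nosol: "\<exists>j<?n. (\<Sum>i\<in>T. z i * A $$ (i, j)) \<noteq> w $ j" for z :: "nat \<Rightarrow> int"
    using w0[of "\<lambda>i. z i - K"]
    by (auto simp: w_def left_diff_distrib sum_subtractf sum_distrib_left)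
  have y1_nonneg: "0 \<le> y1 i" if "i \<in> T" for i
  proof -
    have "\<bar>y0 i\<bar> \<le> K" unfolding K_def using \<open>finite T\<close> that by (intro member_le_sum) auto
    moreover have "1 * K \<le> l * K" using l0 by (intro mult_right_mono) (auto simp: K_def sum_nonneg)
    ultimately show ?thesis unfolding y1_def by linarith
  qed
  have sumT: "(\<Sum>i<?m. h i) = (\<Sum>i\<in>T. h i)" if "\<And>i. i < ?m \<Longrightarrow> i \<notin> T \<Longrightarrow> h i = 0" for h :: "nat \<Rightarrow> real"
    using T that by (intro sum.mono_neutral_right) auto
  define y2 where "y2 i = (if i \<in> T then real_of_int (y1 i) / real_of_int l else 0)" for i
  have feas2: "dual_feas ?m ?n ?a ?w y2"
    unfolding dual_feas_def
  proof (intro conjI allI impI)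
    show "0 \<le> y2 i" for i using y1_nonneg[of i] l0 by (simp add: y2_def)
    fix j assume j: "j < ?n"
    have "(\<Sum>i<?m. y2 i * ?a i j) = (\<Sum>i\<in>T. y2 i * ?a i j)"
      by (rule sumT) (simp add: y2_def)
    also have "\<dots> = real_of_int (\<Sum>i\<in>T. y1 i * A $$ (i, j)) / l"
      by (simp add: y2_def sum_divide_distrib)
    also have "\<dots> = ?w j" using y1[OF j] l0 by simp
    finally show "(\<Sum>i<?m. y2 i * ?a i j) = ?w j" .
  qed
  \<comment> \<open>All rows with weight in \<open>y2\<close> are tight on \<open>F\<close>, so the
    gap closes at every point of \<open>F\<close>. This makes \<open>y2\<close> optimal and every
    point of \<open>F\<close> a maximizer of \<open>w\<close>.\<close>
  have gap2: "(\<Sum>i<?m. y2 i * ?b i) = (\<Sum>j<?n. ?w j * x $ j)" if "x \<in> F" for x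
  proof -
    have "(\<Sum>i<?m. y2 i * (?b i - (\<Sum>j<?n. ?a i j * x $ j))) = 0"
      using that T_iff by (intro sum.neutral) (simp add: y2_def)
    then show ?thesis using duality_gap[OF feas2, of ?b "($) x"] by simp
  qed
  have opt2: "dual_opt ?m ?n ?a ?b ?w y2"
    unfolding dual_opt_def
  proof (intro conjI allI impI feas2)
    fix y' assume "dual_feas ?m ?n ?a ?w y'"
    moreover obtain x where "x \<in> F" using F(2) by blast
    ultimately show "(\<Sum>i<?m. y2 i * ?b i) \<le> (\<Sum>i<?m. y' i * ?b i)"
      unfolding gap2[OF \<open>x \<in> F\<close>] using FP[OF \<open>x \<in> F\<close>]
      by (intro weak_duality) (auto simp: mem_polyhedron_iff)
  qed
  then have "dual_opt ?m ?n ?a ?b ?w (($) (vec ?m y2))"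
    by (simp add: dual_opt_def dual_feas_def)
  then have "dual_optimal A b w (vec ?m y2)"
    by (simp add: dual_optimal_iff[OF w bc])
  then obtain y where "dual_optimal A b w y" and py: "\<And>i. i < ?m \<Longrightarrow> padic p (y $ i)"
    using tdp w unfolding totally_dual_padic_def by blast
  then have opt: "dual_opt ?m ?n ?a ?b ?w (($) y)"
    by (simp add: dual_optimal_iff[OF w bc])
  then have feas: "dual_feas ?m ?n ?a ?w (($) y)" by (simp add: dual_opt_def)
  have val: "(\<Sum>i<?m. y $ i * ?b i) = (\<Sum>i<?m. y2 i * ?b i)"
    using opt opt2 feas feas2 unfolding dual_opt_def by (meson antisym)
  \<comment> \<open>A row outside \<open>T\<close> is slack at some point of \<open>F\<close>;
    complementary slackness there kills its multiplier.\<close>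
  have zero: "y $ i = 0" if i: "i < ?m" "i \<notin> T" for i
  proof -
    obtain x where x: "x \<in> F" "(\<Sum>j<?n. ?a i j * x $ j) \<noteq> ?b i"
      using T_iff[OF i(1)] i(2) by blast
    then show ?thesis
      using complementary_slackness[OF feas, of "($) x" ?b i] FP[OF x(1)] i(1) val gap2[OF x(1)]
      by (auto simp: mem_polyhedron_iff)
  qed
  obtain k u where u: "\<And>i. i \<in> T \<Longrightarrow> real p ^ k * y $ i = real_of_int (u i)"
    using ex_common_padic_exponent[OF \<open>finite T\<close>, of p "($) y"] py T prime_gt_0_nat[OF p] by fastforce
  have pw: "(\<Sum>i\<in>T. u i * A $$ (i, j)) = int p ^ k * w $ j" if j: "j < ?n" for j
  proof -
    have "real_of_int (\<Sum>i\<in>T. u i * A $$ (i, j)) = (\<Sum>i\<in>T. real p ^ k * (y $ i * ?a i j))"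
      by (simp add: u[symmetric] mult.assoc)
    also have "\<dots> = real p ^ k * (\<Sum>i<?m. y $ i * ?a i j)"
      using sumT[of "\<lambda>i. y $ i * ?a i j"] zero by (simp add: sum_distrib_left)
    also have "\<dots> = real_of_int (int p ^ k * w $ j)"
      using feas j by (simp add: dual_feas_def)
    finally show ?thesis by (simp only: of_int_eq_iff)
  qed
  \<comment> \<open>Both \<open>l w\<close> and \<open>p ^ k w\<close> are integral combinations of
    the tight rows, with multipliers \<open>y1\<close> and \<open>u\<close>; a Bezout combination
    gives \<open>w\<close>.\<close>
  have "coprime l (int p ^ k)"
    using l p by (intro coprime_power_right_iff[THEN iffD2] disjI1 primes_coprime) auto
  then obtain \<alpha> \<beta> where ab: "\<alpha> * l + \<beta> * int p ^ k = 1"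
    using bezout_int[of l "int p ^ k"] by (auto simp: coprime_iff_gcd_eq_1)
  have "(\<Sum>i\<in>T. (\<alpha> * y1 i + \<beta> * u i) * A $$ (i, j)) = w $ j" if j: "j < ?n" for j
  proof -
    have "(\<Sum>i\<in>T. (\<alpha> * y1 i + \<beta> * u i) * A $$ (i, j))
        = \<alpha> * (\<Sum>i\<in>T. y1 i * A $$ (i, j)) + \<beta> * (\<Sum>i\<in>T. u i * A $$ (i, j))"
      by (simp add: distrib_right sum.distrib sum_distrib_left mult.assoc)
    also have "\<dots> = (\<alpha> * l + \<beta> * int p ^ k) * w $ j"
      by (simp add: y1[OF j] pw[OF j] distrib_right)
    finally show ?thesis by (simp add: ab)
  qed
  then show False using nosol[of "\<lambda>i. \<alpha> * y1 i + \<beta> * u i"] by blast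
qed

text \<open>A GCD other than 1 has a prime divisor, which differs from \<open>p\<close> or from
  \<open>q\<close>.\<close>

lemma Gcd_subdets_eq_1_if_totally_dual_padic:
  assumes "dim_vec b = dim_row A" "prime (p :: nat)" "prime (q :: nat)" "p \<noteq> q"
    and "totally_dual_padic A b p" "totally_dual_padic A b q" "is_face A b F" "F \<noteq> {}"
  shows "Gcd (subdets (face_matrix A b F) (int_rank (face_matrix A b F))) = 1"
proof (rule ccontr)
  let ?g = "Gcd (subdets (face_matrix A b F) (int_rank (face_matrix A b F)))"
  assume "?g \<noteq> 1"
  then have "\<not> is_unit ?g" by (metis is_unit_normalize normalize_Gcd)
  then obtain l where l: "prime l" "l dvd ?g"
  proof (cases "?g = 0")
    case True
    \<comment> \<open>Every prime divides 0, so 2 serves.\<close>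
    then show ?thesis using that[of 2] by (metis dvd_0_right two_is_prime)
  next
    case False
    then show ?thesis using prime_divisorE[of ?g] that \<open>\<not> is_unit ?g\<close> by blast
  qed
  then have "l \<noteq> int p \<or> l \<noteq> int q" using assms(4) by auto
  then show False
    using prime_not_dvd_Gcd_subdets[OF assms(1) _ l(1)] assms l(2) by blast
qed

theorem theorem1p4:
  fixes A :: "int mat" and b :: "int vec"
  assumes "dim_vec b = dim_row A"
  shows "((\<forall>p::nat. prime p \<longrightarrow> totally_dual_padic A b p) \<longleftrightarrow>
           (\<exists>p q::nat. prime p \<and> prime q \<and> p \<noteq> q \<and>
              totally_dual_padic A b p \<and> totally_dual_padic A b q))
       \<and> ((\<forall>p::nat. prime p \<longrightarrow> totally_dual_padic A b p) \<longleftrightarrow>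
           (\<forall>F. is_face A b F \<and> F \<noteq> {} \<longrightarrow>
              Gcd (subdets (face_matrix A b F) (int_rank (face_matrix A b F))) = 1))"
proof -
  let ?all = "\<forall>p::nat. prime p \<longrightarrow> totally_dual_padic A b p"
  let ?two = "\<exists>p q::nat. prime p \<and> prime q \<and> p \<noteq> q \<and>
    totally_dual_padic A b p \<and> totally_dual_padic A b q"
  let ?gcd = "\<forall>F. is_face A b F \<and> F \<noteq> {} \<longrightarrow>
    Gcd (subdets (face_matrix A b F) (int_rank (face_matrix A b F))) = 1"
  have "?all \<Longrightarrow> ?two"
    by (rule exI[of _ 2], rule exI[of _ 3]) auto
  moreover have "?two \<Longrightarrow> ?gcd"
    using Gcd_subdets_eq_1_if_totally_dual_padic[OF assms] by blast
  moreover have "?gcd \<Longrightarrow> ?all"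
    using totally_dual_padic_if_Gcd_subdets_eq_1[OF assms] by blast
  ultimately show ?thesis by blast
qed

end
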